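(* Let $(V,f)$ and $(W,g)$ be bilinear lattices, $Z=V\otimes W$, and let $z\in Z\otimes\mathbb Q$ be a Wu class for $(Z,f\otimes g)$. Then $$\gamma\big(G_f\otimes W,\varphi_{f\otimes g,z}\circ j_f\big)=e^{\frac{\pi i}{4}\left(\sigma(f)\sigma(g)-(f\otimes g)_{\mathbb Q}(z,z)\right)}\,\overline{\gamma\big(V\otimes G_g,\varphi_{f\otimes g,z}\circ j_g\big)}.$$
   Context: A bilinear lattice $(V,f)$ is a finitely generated free abelian group $V$ with a symmetric nondegenerate bilinear form $f:V\times V\to\mathbb Z$; $f_{\mathbb Q}$ denotes its extension to $V_{\mathbb Q}=V\otimes\mathbb Q$, and $\sigma(f)$ its signature. The dual lattice is $V^{\sharp}=\{x\in V_{\mathbb Q}\mid f_{\mathbb Q}(x,V)\subset\mathbb Z\}$ and $G_f=V^{\sharp}/V$. A Wu class for $(V,f)$ is $v\in V_{\mathbb Q}$ with $f(x,x)-f_{\mathbb Q}(x,v)\in2\mathbb Z$ for all $x\in V$ (integral if $v\in V$). The discriminant of $(V,f,v)$ is the quadratic function $\varphi_{f,v}:G_f\to\mathbb Q/\mathbb Z$, $\varphi_{f,v}(x\bmod V)=\tfrac12\big(f_{\mathbb Q}(x,x)-f_{\mathbb Q}(x,v)\big)\bmod\mathbb Z$ for $x\in V^{\sharp}$. The form $f\otimes g$ on $Z=V\otimes W$ is $(f\otimes g)(x\otimes y,x'\otimes y')=f(x,x')g(y,y')$, and $G_{f\otimes g}=Z^{\sharp}/Z$. The map $j_f:G_f\otimes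 W\to G_{f\otimes g}$ sends $(x\bmod V)\otimes y\mapsto x\otimes y\bmod Z$ ($x\in V^{\sharp},y\in W$); $j_g:V\otimes G_g\to G_{f\otimes g}$ sends $x\otimes(y\bmod W)\mapsto x\otimes y\bmod Z$ ($x\in V,y\in W^{\sharp}$). For a quadratic function $q$ on a finite abelian group $G$ (a map $q:G\to\mathbb Q/\mathbb Z$ with $b_q(x,y)=q(x+y)-q(x)-q(y)$ bilinear), $G^\perp=\{x\mid b_q(x,G)=0\}$ and $\gamma(G,q)=|G|^{-1/2}|G^{\perp}|^{-1/2}\sum_{x\in G}e^{2\pi i q(x)}$; bar denotes complex conjugation. *)

theory Defs
  imports "HOL-Analysis.Analysis" "HOL-Library.Function_Algebras"
begin

text \<open>A bilinear lattice of rank CARD('n) is Z^n with a Gram matrix F (integer valued).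
  Vectors of V_Q are functions 'n => rat; V is the set of integer-valued ones.\<close>

definition Zvec :: "('n \<Rightarrow> rat) set" where
  "Zvec = {x. \<forall>i. x i \<in> \<int>}"

definition formQ :: "('n::finite \<Rightarrow> 'n \<Rightarrow> int) \<Rightarrow> ('n \<Rightarrow> rat) \<Rightarrow> ('n \<Rightarrow> rat) \<Rightarrow> rat" where
  "formQ F x y = (\<Sum>i\<in>UNIV. \<Sum>j\<in>UNIV. x i * of_int (F i j) * y j)"

definition bilinear_lattice :: "('n::finite \<Rightarrow> 'n \<Rightarrow> int) \<Rightarrow> bool" where
  "bilinear_lattice F \<longleftrightarrow> (\<forall>i j. F i j = F j i) \<and>
     (\<forall>x\<in>Zvec. (\<forall>y\<in>Zvec. formQ F x y = 0) \<longrightarrow> x = 0)"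

definition dual_lattice :: "('n::finite \<Rightarrow> 'n \<Rightarrow> int) \<Rightarrow> ('n \<Rightarrow> rat) set" where
  "dual_lattice F = {x. \<forall>y\<in>Zvec. formQ F x y \<in> \<int>}"

definition wu_class :: "('n::finite \<Rightarrow> 'n \<Rightarrow> int) \<Rightarrow> ('n \<Rightarrow> rat) \<Rightarrow> bool" where
  "wu_class F v \<longleftrightarrow> (\<forall>x\<in>Zvec. \<exists>k::int. formQ F x x - formQ F x v = 2 * of_int k)"

text \<open>Discriminant quadratic function phi_{f,v}, as a rational lift of its Q/Z value.\<close>
definition disc :: "('n::finite \<Rightarrow> 'n \<Rightarrow> int) \<Rightarrow> ('n \<Rightarrow> rat) \<Rightarrow> ('n \<Rightarrow> rat) \<Rightarrow> rat" where
  "disc F v x = (formQ F x x - formQ F x v) / 2"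

definition real_qform :: "('n::finite \<Rightarrow> 'n \<Rightarrow> int) \<Rightarrow> real^'n \<Rightarrow> real" where
  "real_qform F x = (\<Sum>i\<in>UNIV. \<Sum>j\<in>UNIV. x$i * of_int (F i j) * x$j)"

definition pos_index :: "('n::finite \<Rightarrow> 'n \<Rightarrow> int) \<Rightarrow> nat" where
  "pos_index F = Max {dim S | S. subspace S \<and> (\<forall>x\<in>S. x \<noteq> 0 \<longrightarrow> real_qform F x > 0)}"

definition neg_index :: "('n::finite \<Rightarrow> 'n \<Rightarrow> int) \<Rightarrow> nat" where
  "neg_index F = Max {dim S | S. subspace S \<and> (\<forall>x\<in>S. x \<noteq> 0 \<longrightarrow> real_qform F x < 0)}"

definition signature :: "('n::finite \<Rightarrow> 'n \<Rightarrow> int) \<Rightarrow> int" where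
  "signature F = int (pos_index F) - int (neg_index F)"

definition tensor_form :: "('n \<Rightarrow> 'n \<Rightarrow> int) \<Rightarrow> ('m \<Rightarrow> 'm \<Rightarrow> int) \<Rightarrow> ('n \<times> 'm) \<Rightarrow> ('n \<times> 'm) \<Rightarrow> int" where
  "tensor_form F G = (\<lambda>(i,k) (j,l). F i j * G k l)"

definition tens :: "('n \<Rightarrow> rat) \<Rightarrow> ('m \<Rightarrow> rat) \<Rightarrow> ('n \<times> 'm \<Rightarrow> rat)" where
  "tens x y = (\<lambda>(i,k). x i * y k)"

definition unitv :: "'k \<Rightarrow> ('k \<Rightarrow> rat)" where
  "unitv k = (\<lambda>l. if l = k then 1 else 0)"

text \<open>G_f (x) W is realised as (V^#)^m / V^m (W = Z^m with standard basis e_k),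
  an element (x_k)_k standing for sum_k (x_k mod V) (x) e_k; j_f sends it to sum_k x_k (x) e_k.\<close>
definition j_f :: "('m::finite \<Rightarrow> 'n \<Rightarrow> rat) \<Rightarrow> ('n \<times> 'm \<Rightarrow> rat)" where
  "j_f x = (\<Sum>k\<in>UNIV. tens (x k) (unitv k))"

text \<open>V (x) G_g realised as (W^#)^n / W^n; j_g sends (y_i)_i to sum_i e_i (x) y_i.\<close>
definition j_g :: "('n::finite \<Rightarrow> 'm \<Rightarrow> rat) \<Rightarrow> ('n \<times> 'm \<Rightarrow> rat)" where
  "j_g y = (\<Sum>i\<in>UNIV. tens (unitv i) (y i))"

text \<open>Gauss-type invariant gamma of a quadratic function q on the finite group A/L
  (q given as a rational lift of a Q/Z-valued function, constant mod Z on cosets).\<close>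
definition cosets :: "'a::ab_group_add set \<Rightarrow> 'a set \<Rightarrow> 'a set set" where
  "cosets A L = (\<lambda>x. (\<lambda>l. x + l) ` L) ` A"

definition qperp :: "'a::ab_group_add set \<Rightarrow> 'a set \<Rightarrow> ('a \<Rightarrow> rat) \<Rightarrow> 'a set set" where
  "qperp A L q = {C \<in> cosets A L. \<forall>D\<in>cosets A L. \<forall>x\<in>C. \<forall>y\<in>D. q (x + y) - q x - q y \<in> \<int>}"

definition gamma :: "'a::ab_group_add set \<Rightarrow> 'a set \<Rightarrow> ('a \<Rightarrow> rat) \<Rightarrow> complex" where
  "gamma A L q =
     (\<Sum>C\<in>cosets A L. exp (2 * of_real pi * \<i> * of_rat (q (SOME x. x \<in> C))))
     / (of_real (sqrt (real (card (cosets A L)))) * of_real (sqrt (real (card (qperp A L q)))))"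

end

theory Submission
  imports Defs
begin

text \<open>
  Put \<open>T = F \<otimes> G\<close>, \<open>L = V \<otimes> W\<close>, \<open>D = L\<^sup>\<sharp>\<close>, \<open>H = V\<^sup>\<sharp> \<otimes> W\<close> and \<open>K = V \<otimes> W\<^sup>\<sharp>\<close>. Inside the discriminant group
  \<open>D / L\<close> the subgroups \<open>H / L\<close> and \<open>K / L\<close> are each other's orthogonal complements. Writing \<open>S\<^sub>X\<close> for the Gauss
  sum of \<open>\<phi>\<close> over \<open>X / L\<close>, a translation and the orthogonality of characters give
  \<open>S\<^sub>D * cnj S\<^sub>K = card (K / L) * S\<^sub>H\<close>, which reduces the theorem to the phase of \<open>S\<^sub>D\<close>, that is, to the
  Milgram--van der Blij formula for \<open>T\<close>.

  The same identity shows that the phase of \<open>S\<^sub>D\<close> does not change when \<open>L\<close> is replaced by a sublattice of finite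
  index. Over the rationals \<open>F\<close> and \<open>G\<close> are diagonalisable, hence \<open>L\<close> may be taken to be an orthogonal
  sum of rank one lattices, and \<open>S\<^sub>D\<close> becomes a product of the classical sums of \<open>exp (\<pi> \<i> j\<^sup>2 / d)\<close>. After
  division by the square root of \<open>d\<close> such a sum depends only on \<open>d\<close> modulo squares, whereas along \<open>d t\<^sup>2\<close>, as \<open>t\<close>
  grows, it is a Riemann sum for the Fresnel integral; so its value is the same for all \<open>d\<close>, and \<open>d = 2\<close> gives
  \<open>exp (\<pi> \<i> / 4)\<close>.
\<close>

section \<open>Quadratic Gauss sums\<close>

text \<open>For \<open>N > 0\<close>, replacing \<open>j\<close> by \<open>j + N\<close> multiplies
  the value by \<open>(-1) ^ N\<close>, because the exponent carries \<open>\<pi>\<close> and not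
  \<open>2 \<pi>\<close>. Only for even \<open>N\<close> is this a function of \<open>j\<close>
  modulo \<open>N\<close>, hence the evenness hypotheses below.\<close>

definition chirp :: "nat \<Rightarrow> nat \<Rightarrow> complex" where
  "chirp N j = cis (pi * (real j)\<^sup>2 / real N)"

definition quad_gauss :: "nat \<Rightarrow> complex" where
  "quad_gauss N = (\<Sum>j<N. chirp N j)"

lemma cis_even_multiple [simp]: "cis (2 * pi * real n) = 1"
  by (metis cis_multiple_2pi Ints_of_nat of_nat_mult of_int_of_nat_eq)

lemma norm_chirp [simp]: "norm (chirp N j) = 1"
  by (simp add: chirp_def)

text \<open>\<open>(N - j)\<^sup>2 / N = N - 2 j + j\<^sup>2 / N\<close>, and \<open>N\<close> is
  even, so the two arguments differ by a multiple of \<open>2 \<pi>\<close>.\<close>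

lemma chirp_reflect:
  assumes "even N" "j \<le> N"
  shows "chirp N (N - j) = chirp N j"
proof (cases "N = 0")
  case False
  obtain M where M: "N = 2 * M" using assms by blast
  have "pi * (real (N - j))\<^sup>2 / real N = pi * (real j)\<^sup>2 / real N + 2 * pi * real M - 2 * pi * real j"
    using False assms M by (simp add: of_nat_diff field_simps power2_eq_square)
  then show ?thesis
    unfolding chirp_def by (simp add: cis_mult[symmetric] cis_divide[symmetric])
qed (use assms in simp)

text \<open>Reflection carries the upper half of the range to \<open>{1..M}\<close>, which differs
  from \<open>{..<M}\<close> only in the end terms at \<open>0\<close> and \<open>M\<close>, each of
  norm 1.\<close>

lemma quad_gauss_half:
  "norm (quad_gauss (2 * M) - 2 * (\<Sum>j<M. chirp (2 * M) j)) \<le> 2"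
proof -
  let ?u = "chirp (2 * M)"
  have "quad_gauss (2 * M) = (\<Sum>j<M. ?u j) + (\<Sum>j\<in>{M..<2*M}. ?u j)"
    unfolding quad_gauss_def
    by (subst sum.union_disjoint[symmetric]) (auto intro!: sum.cong)
  also have "(\<Sum>j\<in>{M..<2*M}. ?u j) = (\<Sum>j\<in>{1..M}. ?u j)"
    by (rule sum.reindex_bij_witness[of _ "\<lambda>j. 2*M - j" "\<lambda>j. 2*M - j"])
       (auto simp: chirp_reflect)
  also have "(\<Sum>j\<in>{1..M}. ?u j) = (\<Sum>j<M. ?u (Suc j))"
    by (rule sum.reindex_bij_witness[of _ Suc "\<lambda>j. j - 1"]) auto
  also have "\<dots> = (\<Sum>j<M. ?u j) + (?u M - ?u 0)"
    using sum_lessThan_telescope[of ?u M] by (simp add: sum_subtractf algebra_simps)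
  finally have "quad_gauss (2 * M) - 2 * (\<Sum>j<M. ?u j) = ?u M - ?u 0" by simp
  then show ?thesis using norm_triangle_ineq4[of "?u M" "?u 0"] by simp
qed

text \<open>A geometric series in a \<open>t\<close>-th root of unity, which equals 1 exactly when
  \<open>t dvd a\<close>.\<close>

lemma sum_roots_of_unity:
  fixes a t :: nat
  assumes "t > 0"
  shows "(\<Sum>b<t. cis (2 * pi * real a * real b / real t)) = (if t dvd a then of_nat t else 0)"
proof -
  let ?w = "cis (2 * pi * real a / real t)"
  have pw: "cis (2 * pi * real a * real b / real t) = ?w ^ b" for b
    by (subst Complex.DeMoivre) (simp add: ac_simps)
  have one: "?w = 1 \<longleftrightarrow> t dvd a"
  proof
    assume "t dvd a"
    then obtain c where "a = t * c" by blast
    then have "2 * pi * real a / real t = 2 * pi * real c" using assms by simp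
    then show "?w = 1" by simp
  next
    assume "?w = 1"
    then have "cos (2 * pi * real a / real t) = 1" by (simp add: complex_eq_iff)
    then obtain n :: int where "2 * pi * real a / real t = of_int n * 2 * pi"
      using cos_one_2pi_int by blast
    then have "real a = of_int n * real t" using assms by (simp add: field_simps)
    then have "int a = n * int t"
      by (metis of_int_eq_iff of_int_mult of_int_of_nat_eq)
    then show "t dvd a" by (metis dvd_triv_right int_dvd_int_iff)
  qed
  have wt: "?w ^ t = 1"
  proof -
    have "real t * (2 * pi * real a / real t) = 2 * pi * real a" using assms by simp
    then show ?thesis by (simp add: Complex.DeMoivre)
  qed
  show ?thesis
  proof (cases "t dvd a")
    case True
    then show ?thesis using one by (simp add: pw)
  next
    case False
    then have "(\<Sum>b<t. ?w ^ b) = 0"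
      using one wt by (subst geometric_sum) auto
    then show ?thesis using False by (simp add: pw)
  qed
qed

text \<open>Writing \<open>j = a + d t b\<close>, the sum over \<open>b\<close> kills all \<open>a\<close> not divisible by \<open>t\<close>.\<close>

lemma quad_gauss_square_multiple:
  assumes "even d" "d > 0" "t > 0"
  shows "quad_gauss (d * t\<^sup>2) = of_nat t * quad_gauss d"
proof -
  obtain M where M: "d = 2 * M" using assms by blast
  let ?N = "d * t\<^sup>2"
  have split: "chirp ?N (a + d * t * b) = chirp ?N a * cis (2 * pi * real a * real b / real t)" for a b
  proof -
    have "pi * (real (a + d * t * b))\<^sup>2 / real ?N =
        pi * (real a)\<^sup>2 / real ?N + 2 * pi * real a * real b / real t + 2 * pi * real (M * b\<^sup>2)"
      using assms M by (simp add: field_simps power2_eq_square)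
    then show ?thesis
      unfolding chirp_def by (simp only: cis_mult[symmetric] cis_even_multiple mult_1_right)
  qed
  have "quad_gauss ?N = (\<Sum>(a,b)\<in>{..<d*t} \<times> {..<t}. chirp ?N (a + d * t * b))"
    unfolding quad_gauss_def
  proof (rule sum.reindex_bij_witness[of _ "\<lambda>(a,b). a + d * t * b" "\<lambda>j. (j mod (d*t), j div (d*t))"])
    fix j assume "j \<in> {..<d * t\<^sup>2}"
    then show "(j mod (d * t), j div (d * t)) \<in> {..<d * t} \<times> {..<t}"
      using assms by (auto simp: power2_eq_square less_mult_imp_div_less ac_simps)
  next
    fix p assume p: "p \<in> {..<d * t} \<times> {..<t}"
    then obtain a b where ab: "p = (a, b)" "a < d * t" "b < t" by auto
    have "a + d * t * b < d * t + d * t * b" using ab by simp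
    also have "\<dots> = d * t * Suc b" by simp
    also have "\<dots> \<le> d * t * t" using ab by (intro mult_le_mono2) simp
    finally show "(case p of (a, b) \<Rightarrow> a + d * t * b) \<in> {..<d * t\<^sup>2}"
      using ab by (simp add: power2_eq_square ac_simps)
  qed (use assms in auto)
  also have "\<dots> = (\<Sum>a<d*t. \<Sum>b<t. chirp ?N a * cis (2 * pi * real a * real b / real t))"
    by (simp add: sum.cartesian_product[symmetric] split)
  also have "\<dots> = (\<Sum>a<d*t. if t dvd a then of_nat t * chirp ?N a else 0)"
    using sum_roots_of_unity[OF \<open>t > 0\<close>]
    by (intro sum.cong) (auto simp: sum_distrib_left[symmetric])
  also have "\<dots> = (\<Sum>a\<in>{a. a < d * t \<and> t dvd a}. of_nat t * chirp ?N a)"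
    by (rule sum.mono_neutral_cong_right) auto
  also have "\<dots> = (\<Sum>a<d. of_nat t * chirp d a)"
  proof (rule sum.reindex_bij_witness[of _ "\<lambda>a. t * a" "\<lambda>a. a div t"])
    fix a assume "a \<in> {a. a < d * t \<and> t dvd a}"
    then obtain c where c: "a = t * c" by blast
    have "chirp d c = chirp ?N (t * c)"
      unfolding chirp_def using assms by (simp add: field_simps power2_eq_square)
    then show "of_nat t * chirp d (a div t) = of_nat t * chirp (d * t\<^sup>2) a" using c assms by simp
  qed (use assms in \<open>auto simp: less_mult_imp_div_less ac_simps\<close>)
  finally show ?thesis by (simp add: quad_gauss_def sum_distrib_left)
qed

section \<open>The tail of the Gauss sum by Abel summation\<close>

lemma norm_cis_diff_le: "norm (cis a - cis b) \<le> \<bar>a - b\<bar>"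
proof -
  have "cis a - cis b = cis b * (exp (\<i> * of_real (a - b)) - 1)"
    by (simp add: cis_conv_exp algebra_simps exp_add[symmetric])
  then have "norm (cis a - cis b) = 2 * \<bar>sin ((a - b) / 2)\<bar>"
    by (simp only: norm_mult norm_cis dist_exp_i_1 mult_1)
  also have "\<dots> \<le> \<bar>a - b\<bar>"
    using abs_sin_x_le_abs_x[of "(a - b) / 2"] by simp
  finally show ?thesis .
qed

text \<open>\<open>sin x - x * cos x\<close> vanishes at 0 and has the nonnegative derivative
  \<open>x * sin x\<close>. The inequality serves to bound the Abel weight \<open>1 / tan t\<close>
  by \<open>1 / t\<close>.\<close>

lemma le_tan:
  fixes x :: real
  assumes "0 \<le> x" "x < pi / 2"
  shows "x \<le> tan x"
proof -
  have "x * cos x \<le> sin x"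
  proof -
    have "sin 0 - 0 * cos (0::real) \<le> sin x - x * cos x"
    proof (rule DERIV_nonneg_imp_nondecreasing[OF assms(1)])
      fix y :: real assume "0 \<le> y" "y \<le> x"
      then have "0 \<le> y * sin y" using assms by (intro mult_nonneg_nonneg sin_ge_zero) auto
      moreover have "((\<lambda>x. sin x - x * cos x) has_real_derivative y * sin y) (at y)"
        by (auto intro!: derivative_eq_intros)
      ultimately show "\<exists>d. ((\<lambda>x. sin x - x * cos x) has_real_derivative d) (at y) \<and> 0 \<le> d" by blast
    qed
    then show ?thesis by simp
  qed
  moreover have "cos x > 0" using assms by (intro cos_gt_zero_pi) auto
  ultimately show ?thesis by (simp add: tan_def field_simps)
qed

text \<open>Summation by parts moves the differences onto the monotone weights, whose drops
  telescope; the bound is therefore independent of \<open>n\<close>.\<close>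

lemma norm_sum_diff_antimono_le:
  fixes u :: "nat \<Rightarrow> complex" and c :: "nat \<Rightarrow> real"
  assumes c: "\<And>j. c (Suc j) \<le> c j" "\<And>j. 0 \<le> c j" and u: "\<And>j. norm (u j) \<le> 1"
  shows "norm (\<Sum>j<n. (u (Suc j) - u j) * of_real (c j)) \<le> 2 * c 0"
proof -
  let ?S = "\<lambda>n. \<Sum>j<n. (u (Suc j) - u j) * of_real (c j)"
  have nb: "norm (u j * of_real r) \<le> r" if "r \<ge> 0" for j r
    using u[of j] that by (simp add: norm_mult mult_left_le_one_le)
  \<comment> \<open>Subtracting the boundary term makes the induction close: one step adds
    \<open>u (Suc n)\<close> times the drop \<open>c n - c (Suc n)\<close>, which is exactly what
    the bound gains.\<close>
  have "norm (?S n - u n * of_real (c n)) \<le> 2 * c 0 - c n"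
  proof (induction n)
    case 0
    then show ?case using nb[of "c 0" 0] c by simp
  next
    case (Suc n)
    have "?S (Suc n) - u (Suc n) * of_real (c (Suc n)) =
      (?S n - u n * of_real (c n)) + u (Suc n) * of_real (c n - c (Suc n))"
      by (simp add: algebra_simps)
    moreover have "norm (u (Suc n) * of_real (c n - c (Suc n))) \<le> c n - c (Suc n)"
      using c by (intro nb) simp
    ultimately show ?case using Suc.IH norm_triangle_ineq by (smt (verit))
  qed
  moreover have "norm (u n * of_real (c n)) \<le> c n" using nb c by blast
  ultimately show ?thesis using norm_triangle_sub[of "?S n" "u n * of_real (c n)"] by linarith
qed

text \<open>This form, with the monotone factor \<open>1 / tan t\<close>, is what Abel summation needs (Estermann's trick for the
  sign of the Gauss sum).\<close>

lemma chirp_diff: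
  assumes "N > 0" "0 < t" "t < pi / 2" "t = pi * (2 * real j + 1) / (2 * real N)"
  shows "chirp N j = - (chirp N (Suc j) - chirp N j) / 2
                     - \<i> / 2 * ((chirp N (Suc j) - chirp N j) * of_real (1 / tan t))"
proof -
  have st: "sin t > 0" "cos t > 0" using assms(2,3) by (auto intro!: sin_gt_zero cos_gt_zero)
  \<comment> \<open>The phase increases by \<open>2 t\<close> from \<open>j\<close> to
    \<open>Suc j\<close>; this is the origin of the odd numerator \<open>2 j + 1\<close> in
    \<open>t\<close>.\<close>
  have "pi * (real (Suc j))\<^sup>2 / real N = pi * (real j)\<^sup>2 / real N + (t + t)"
    using assms by (simp add: field_simps power2_eq_square)
  then have "chirp N (Suc j) = chirp N j * (cis t * cis t)"
    unfolding chirp_def by (simp only: cis_mult)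
  then have d: "chirp N (Suc j) - chirp N j = chirp N j * (cis t * cis t - 1)"
    by (simp add: algebra_simps)
  have "(cis t * cis t - 1) * (of_real (sin t) + \<i> * of_real (cos t)) = - 2 * of_real (sin t)"
  proof -
    have a: "of_real (sin t) + \<i> * of_real (cos t) = \<i> * cis (- t)"
      by (simp add: complex_eq_iff)
    have "(cis t * cis t - 1) * (\<i> * cis (-t)) = \<i> * (cis t - cis (-t))"
      by (simp add: algebra_simps cis_mult)
    also have "\<dots> = - 2 * of_real (sin t)" by (simp add: complex_eq_iff)
    finally show ?thesis using a by simp
  qed
  then have k: "(cis t * cis t - 1) * (1 + \<i> * of_real (1 / tan t)) = - 2"
    using st by (simp add: tan_def field_simps)
  have "- (chirp N (Suc j) - chirp N j) / 2
       - \<i> / 2 * ((chirp N (Suc j) - chirp N j) * of_real (1 / tan t))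
     = - chirp N j / 2 * ((cis t * cis t - 1) * (1 + \<i> * of_real (1 / tan t)))"
  proof -
    have "- (x * w) / 2 - \<i> / 2 * ((x * w) * r) = - x / 2 * (w * (1 + \<i> * r))" for x w r :: complex
      by (simp add: field_simps)
    then show ?thesis unfolding d .
  qed
  also have "\<dots> = chirp N j" unfolding k by simp
  finally show ?thesis by simp
qed

text \<open>The weights \<open>1 / tan (t j)\<close> decrease because \<open>t j\<close> grows and
  stays below \<open>\<pi> / 2\<close> while \<open>a + j < M\<close>; this confines the estimate to
  the first half of the period. The telescoping part costs at most 1, and the first weight is at
  most \<open>1 / t 0\<close>, which is of order \<open>M / a\<close>.\<close>

lemma norm_chirp_tail_le:
  assumes "0 < a" "a \<le> M"
  shows "norm (\<Sum>j\<in>{a..<M}. chirp (2 * M) j) \<le> 1 + 2 * real M / real a"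
proof -
  define u where "u j = chirp (2 * M) (a + j)" for j
  define t where "t j = pi * (2 * real (a + j) + 1) / (2 * real (2 * M))" for j
  \<comment> \<open>Continuing by 0 keeps the weights nonnegative and decreasing at every index, as
    the summation by parts requires.\<close>
  define c where "c j = (if a + j < M then 1 / tan (t j) else 0)" for j
  have t: "0 < t j" "t j < pi / 2" if "a + j < M" for j
  proof -
    show "0 < t j" using assms that unfolding t_def by (intro divide_pos_pos mult_pos_pos) auto
    have "2 * real (a + j) + 1 < 2 * real M"
      using that of_nat_less_iff[of "2 * (a + j) + 1" "2 * M", where ?'a = real] by simp
    then have "pi * (2 * real (a + j) + 1) < pi * (2 * real M)" by simp
    then show "t j < pi / 2" using assms unfolding t_def by (simp add: field_simps)
  qed
  have tan_pos: "0 < tan (t j)" if "a + j < M" for j using t[OF that] by (rule tan_gt_zero)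
  have c_mono: "c (Suc j) \<le> c j" for j
  proof (cases "a + Suc j < M")
    case True
    have "t j \<le> t (Suc j)" unfolding t_def by (intro divide_right_mono mult_left_mono) auto
    then have "tan (t j) \<le> tan (t (Suc j))"
      using t[of j] t[of "Suc j"] True pi_gt_zero by (intro tan_mono_le) linarith+
    then show ?thesis using True tan_pos[of j] by (auto simp: c_def intro!: divide_left_mono mult_pos_pos tan_pos)
  next
    case False
    then show ?thesis using tan_pos[of j] by (auto simp: c_def)
  qed
  have c_nonneg: "0 \<le> c j" for j using tan_pos[of j] by (auto simp: c_def)
  have c0: "c 0 \<le> 2 * real M / real a"
  proof (cases "a < M")
    case True
    have "t 0 \<le> tan (t 0)" using t[of 0] True by (intro le_tan) auto
    then have "c 0 \<le> 1 / t 0" using True t[of 0] by (auto simp: c_def intro!: divide_left_mono mult_pos_pos tan_pos)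
    also have "\<dots> = 4 * real M / (pi * (2 * real a + 1))" by (simp add: t_def)
    also have "\<dots> \<le> 4 * real M / (2 * real a)"
    proof (intro divide_left_mono)
      have "1 * (2 * real a) \<le> pi * (2 * real a + 1)" using pi_ge_two by (intro mult_mono) auto
      then show "2 * real a \<le> pi * (2 * real a + 1)" by simp
    qed (use assms in auto)
    finally show ?thesis by simp
  qed (use assms in \<open>auto simp: c_def\<close>)
  have "(\<Sum>j\<in>{a..<M}. chirp (2 * M) j) = (\<Sum>j<M - a. u j)"
    by (rule sum.reindex_bij_witness[of _ "\<lambda>j. a + j" "\<lambda>j. j - a"]) (auto simp: u_def)
  also have "\<dots> = (\<Sum>j<M - a. - (u (Suc j) - u j) / 2 - \<i> / 2 * ((u (Suc j) - u j) * of_real (c j)))"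
  proof (intro sum.cong refl)
    fix j assume "j \<in> {..<M - a}"
    then have "a + j < M" by auto
    then show "u j = - (u (Suc j) - u j) / 2 - \<i> / 2 * ((u (Suc j) - u j) * of_real (c j))"
      using chirp_diff[of "2 * M" "t j" "a + j"] t[of j]
      by (simp add: u_def c_def t_def add.commute)
  qed
  also have "\<dots> = - (u (M - a) - u 0) / 2 - \<i> / 2 * (\<Sum>j<M - a. (u (Suc j) - u j) * of_real (c j))"
  proof -
    define w where "w j = u (Suc j) - u j" for j
    have "(\<Sum>j<M - a. w j) = u (M - a) - u 0" by (simp add: w_def sum_lessThan_telescope)
    then have "(\<Sum>j<M - a. - w j / 2 - \<i> / 2 * (w j * of_real (c j))) =
        - (u (M - a) - u 0) / 2 - \<i> / 2 * (\<Sum>j<M - a. w j * of_real (c j))"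
      by (simp only: sum_subtractf sum_divide_distrib[symmetric] sum_negf sum_distrib_left[symmetric])
    then show ?thesis by (simp only: w_def)
  qed
  also have "norm \<dots> \<le> 1 + c 0"
  proof -
    have "norm (- (u (M - a) - u 0) / 2) \<le> 1"
      using norm_triangle_ineq4[of "u (M - a)" "u 0"] by (simp add: u_def norm_minus_commute)
    moreover have "norm (\<i> / 2 * (\<Sum>j<M - a. (u (Suc j) - u j) * of_real (c j))) \<le> c 0"
      using norm_sum_diff_antimono_le[of c u "M - a", OF c_mono c_nonneg]
      by (simp add: norm_mult u_def)
    ultimately show ?thesis by (meson norm_triangle_ineq4 add_mono order_trans)
  qed
  finally show ?thesis using c0 by simp
qed

section \<open>Comparison with the Fresnel integral\<close>

definition fresnel :: "real \<Rightarrow> complex" where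
  "fresnel x = integral {0..x} (\<lambda>t. cis (pi * t\<^sup>2))"

lemma fresnel_integrable: "(\<lambda>t. cis (pi * t\<^sup>2)) integrable_on {a..b}"
  by (intro integrable_continuous_interval continuous_intros)

lemma fresnel_diff:
  assumes "0 \<le> x" "x \<le> y"
  shows "fresnel y - fresnel x = integral {x..y} (\<lambda>t. cis (pi * t\<^sup>2))"
  using Henstock_Kurzweil_Integration.integral_combine[OF assms fresnel_integrable]
  by (simp add: fresnel_def algebra_simps)

lemma norm_fresnel_diff_le:
  assumes "0 \<le> x" "x \<le> y"
  shows "norm (fresnel y - fresnel x) \<le> y - x"
  using integral_bound[of x y "\<lambda>t. cis (pi * t\<^sup>2)" 1] assms
  by (simp add: fresnel_diff continuous_intros)

text \<open>The left endpoint rule on one interval: the integrand has Lipschitz constant at most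
  \<open>2 \<pi> y\<close> there.\<close>

lemma norm_fresnel_diff_approx:
  assumes "0 \<le> x" "x \<le> y"
  shows "norm (fresnel y - fresnel x - (y - x) * cis (pi * x\<^sup>2)) \<le> 2 * pi * y * (y - x)\<^sup>2"
proof -
  have "fresnel y - fresnel x - (y - x) * cis (pi * x\<^sup>2)
      = integral {x..y} (\<lambda>t. cis (pi * t\<^sup>2) - cis (pi * x\<^sup>2))"
    using assms by (subst Henstock_Kurzweil_Integration.integral_diff)
      (auto simp: fresnel_diff fresnel_integrable scaleR_conv_of_real)
  also have "norm \<dots> \<le> 2 * pi * y * (y - x) * (y - x)"
  proof (rule integral_bound[OF assms(2)])
    fix t assume t: "t \<in> {x..y}"
    have "norm (cis (pi * t\<^sup>2) - cis (pi * x\<^sup>2)) \<le> \<bar>pi * t\<^sup>2 - pi * x\<^sup>2\<bar>" by (rule norm_cis_diff_le)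
    also have "pi * t\<^sup>2 - pi * x\<^sup>2 = pi * ((t + x) * (t - x))" by (simp add: algebra_simps power2_eq_square)
    also have "\<bar>\<dots>\<bar> = pi * ((t + x) * (t - x))" using t assms by (simp add: abs_mult)
    also have "\<dots> \<le> pi * ((2 * y) * (y - x))" using t assms by (intro mult_left_mono mult_mono) auto
    finally show "norm (cis (pi * t\<^sup>2) - cis (pi * x\<^sup>2)) \<le> 2 * pi * y * (y - x)" by (simp add: ac_simps)
  qed (intro continuous_intros)
  finally show ?thesis by (simp add: power2_eq_square ac_simps)
qed

text \<open>\<open>chirp N j\<close> is the integrand at \<open>j / sqrt N\<close>, so the partial
  sum is a left Riemann sum with step \<open>1 / sqrt N\<close>. Each of the \<open>m\<close> cells
  contributes an error of at most \<open>2 \<pi> m / sqrt N ^ 3\<close>.\<close>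

lemma norm_fresnel_riemann_sum_le:
  assumes "N > 0"
  shows "norm (fresnel (real m / sqrt N) - (\<Sum>j<m. chirp N j) / sqrt N) \<le> 2 * pi * (real m)\<^sup>2 / sqrt N ^ 3"
proof -
  define s where "s = sqrt N"
  have s: "s > 0" "s\<^sup>2 = real N" using assms by (auto simp: s_def)
  have "norm (fresnel (real k / s) - (\<Sum>j<k. chirp N j) / s) \<le> real k * (2 * pi * real m / s ^ 3)"
    if "k \<le> m" for k
    using that
  proof (induction k)
    case (Suc k)
    have ch: "cis (pi * (real k / s)\<^sup>2) = chirp N k"
      using s by (simp add: chirp_def power_divide)
    have "norm (fresnel (real (Suc k) / s) - fresnel (real k / s) - (real (Suc k) / s - real k / s) * cis (pi * (real k / s)\<^sup>2))
       \<le> 2 * pi * (real (Suc k) / s) * (real (Suc k) / s - real k / s)\<^sup>2"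
      using s norm_fresnel_diff_approx[of "real k / s" "real (Suc k) / s"] by (simp add: divide_right_mono)
    also have "real (Suc k) / s - real k / s = 1 / s" by (simp add: diff_divide_distrib[symmetric])
    also have "2 * pi * (real (Suc k) / s) * (1 / s)\<^sup>2 = 2 * pi * real (Suc k) / s ^ 3"
      using s by (simp add: field_simps power2_eq_square power3_eq_cube)
    also have "\<dots> \<le> 2 * pi * real m / s ^ 3"
      using s Suc.prems by (intro divide_right_mono mult_left_mono) auto
    finally have st: "norm (fresnel (real (Suc k) / s) - fresnel (real k / s) - chirp N k / s) \<le> 2 * pi * real m / s ^ 3"
      unfolding ch by simp
    have "fresnel (real (Suc k) / s) - (\<Sum>j<Suc k. chirp N j) / s =
       (fresnel (real k / s) - (\<Sum>j<k. chirp N j) / s) + (fresnel (real (Suc k) / s) - fresnel (real k / s) - chirp N k / s)"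
      by (simp add: add_divide_distrib)
    then show ?case
      using norm_triangle_mono[OF Suc.IH st] Suc.prems by (simp add: algebra_simps add_divide_distrib)
  qed (simp add: fresnel_def)
  from this[of m] show ?thesis by (simp add: s_def power2_eq_square ac_simps)
qed

text \<open>Half of the Gauss sum is cut near \<open>X sqrt (2 M)\<close>: below the cut it is a
  Riemann sum, beyond it the Abel estimate applies. Only the term \<open>2 / X\<close> of the bound
  survives as \<open>M\<close> grows with \<open>X\<close> fixed.\<close>

lemma quad_gauss_fresnel:
  assumes "X > 0" and "2 * X + 2 \<le> sqrt (2 * M)"
  shows "norm (quad_gauss (2 * M) / sqrt (2 * M) - 2 * fresnel X)
          \<le> 2 / X + (6 + 4 * pi * (X + 1)\<^sup>2) / sqrt (2 * M)"
proof -
  define s where "s = sqrt (2 * M)"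
  have s: "s \<ge> 2 * X + 2" "s\<^sup>2 = 2 * real M" using assms by (auto simp: s_def)
  have s1: "s \<ge> 1" "s > 0" using assms s by linarith+
  have M: "M > 0" using s1 s by (cases M) auto
  \<comment> \<open>The least index whose sample point \<open>m / s\<close> is not below
    \<open>X\<close>; the second hypothesis will give \<open>m \<le> M\<close>.\<close>
  define m where "m = nat \<lceil>X * s\<rceil>"
  have m: "X * s \<le> real m" "real m \<le> X * s + 1"
    using assms s1 by (auto simp: m_def)
  have "0 < X * s" using assms s1 by simp
  then have m0: "0 < m" using m by linarith
  have "X * s + 1 \<le> (X + 1) * s" using s1 by (simp add: algebra_simps)
  then have mX: "real m \<le> (X + 1) * s" using m by linarith
  also have "\<dots> \<le> s / 2 * s" using s s1 by (intro mult_right_mono) auto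
  finally have "m \<le> M" using s(2) by (simp add: power2_eq_square)
  have "(\<Sum>j<M. chirp (2 * M) j) = (\<Sum>j<m. chirp (2 * M) j) + (\<Sum>j\<in>{m..<M}. chirp (2 * M) j)"
    using \<open>m \<le> M\<close> by (subst sum.union_disjoint[symmetric]) (auto intro!: sum.cong)
  \<comment> \<open>The four errors are those of the reflection (\<open>?A\<close>), the tail
    (\<open>?B\<close>), the Riemann sum (\<open>?C\<close>) and the rounding of \<open>X\<close> to
    a sample point (\<open>?D\<close>).\<close>
  then have "quad_gauss (2 * M) / s - 2 * fresnel X =
      (quad_gauss (2 * M) - 2 * (\<Sum>j<M. chirp (2 * M) j)) / s
      + 2 * ((\<Sum>j\<in>{m..<M}. chirp (2 * M) j) / s)
      - 2 * (fresnel (real m / s) - (\<Sum>j<m. chirp (2 * M) j) / s)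
      + 2 * (fresnel (real m / s) - fresnel X)" (is "_ = ?A + ?B - ?C + ?D")
    by (simp add: algebra_simps add_divide_distrib diff_divide_distrib)
  moreover have "norm ?A \<le> 2 / s"
    using quad_gauss_half[of M] s1 by (simp add: norm_divide divide_right_mono)
  moreover have "norm ?B \<le> 2 / s + 2 / X"
  proof -
    have "norm ?B \<le> 2 * (1 + s\<^sup>2 / real m) / s"
      using norm_chirp_tail_le[OF m0 \<open>m \<le> M\<close>] s s1
      by (simp add: norm_mult norm_divide divide_right_mono)
    also have "s\<^sup>2 / real m \<le> s\<^sup>2 / (X * s)"
      using m m0 assms s1 by (intro divide_left_mono) auto
    also have "s\<^sup>2 / (X * s) = s / X" using s1 by (simp add: power2_eq_square)
    finally have "norm ?B \<le> 2 * (1 + s / X) / s" using s1 by (simp add: divide_right_mono)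
    then show ?thesis using s1 assms by (simp add: field_simps)
  qed
  moreover have "norm ?C \<le> 4 * pi * (X + 1)\<^sup>2 / s"
  proof -
    have "norm ?C \<le> 2 * (2 * pi * (real m)\<^sup>2 / s ^ 3)"
      using norm_fresnel_riemann_sum_le[of "2 * M" m] M
      unfolding s_def norm_mult norm_numeral by (intro mult_left_mono) auto
    also have "\<dots> \<le> 2 * (2 * pi * ((X + 1) * s)\<^sup>2 / s ^ 3)"
      using mX s1 by (intro mult_left_mono divide_right_mono power_mono) auto
    also have "\<dots> = 4 * pi * (X + 1)\<^sup>2 / s" using s1 by (simp add: field_simps power2_eq_square power3_eq_cube)
    finally show ?thesis .
  qed
  moreover have "norm ?D \<le> 2 / s"
  proof -
    have "X \<le> real m / s" using m s1 by (simp add: field_simps)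
    moreover have "real m / s \<le> X + 1 / s"
      using divide_right_mono[OF m(2), of s] s1 by (simp add: add_divide_distrib)
    ultimately have "X \<le> real m / s" "real m / s - X \<le> 1 / s" by auto
    then have "norm (fresnel (real m / s) - fresnel X) \<le> 1 / s"
      using norm_fresnel_diff_le[of X "real m / s"] assms by linarith
    then show ?thesis unfolding norm_mult norm_numeral by simp
  qed
  ultimately have "norm (quad_gauss (2 * M) / s - 2 * fresnel X)
      \<le> 2 / s + (2 / s + 2 / X) + 4 * pi * (X + 1)\<^sup>2 / s + 2 / s"
    by (smt (verit) norm_triangle_ineq norm_triangle_ineq4)
  then show ?thesis by (simp add: s_def add_divide_distrib)
qed

text \<open>The previous bound is applied to \<open>d t\<^sup>2\<close>. The normalised sum does not
  depend on \<open>t\<close>, so \<open>t\<close> may tend to infinity while \<open>X\<close> stays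
  fixed. A truncated integral suffices, since it will only serve to compare two values of
  \<open>d\<close>.\<close>

lemma quad_gauss_near_fresnel:
  assumes "even d" "d > 0" "X > 0"
  shows "norm (quad_gauss d / sqrt d - 2 * fresnel X) \<le> 2 / X"
proof -
  obtain M where M: "d = 2 * M" using assms by blast
  define K where "K = 6 + 4 * pi * (X + 1)\<^sup>2"
  have bound: "norm (quad_gauss d / sqrt d - 2 * fresnel X) \<le> 2 / X + K / (real t * sqrt d)"
    if t: "t > 0" "2 * X + 2 \<le> real t * sqrt d" for t
  proof -
    have st: "sqrt (2 * real (M * t\<^sup>2)) = real t * sqrt d"
      using M by (simp add: real_sqrt_mult)
    have "quad_gauss (2 * (M * t\<^sup>2)) = of_nat t * quad_gauss d"
      using quad_gauss_square_multiple[of d t] assms M t by (simp add: mult.assoc)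
    then have "quad_gauss (2 * (M * t\<^sup>2)) / sqrt (2 * real (M * t\<^sup>2)) = quad_gauss d / sqrt d"
      unfolding st using t by simp
    then show ?thesis
      using quad_gauss_fresnel[of X "M * t\<^sup>2"] assms st t by (simp add: K_def)
  qed
  have "(\<lambda>t. 2 / X + K / (real t * sqrt d)) \<longlonglongrightarrow> 2 / X + 0"
    using assms by (intro tendsto_intros real_tendsto_divide_at_top
       filterlim_at_top_mult_tendsto_pos[OF tendsto_const] filterlim_real_sequentially) auto
  moreover have "\<forall>\<^sub>F t in sequentially. norm (quad_gauss d / sqrt d - 2 * fresnel X) \<le> 2 / X + K / (real t * sqrt d)"
  proof -
    have "filterlim (\<lambda>t. real t * sqrt d) at_top sequentially"
      using assms by (intro filterlim_at_top_mult_tendsto_pos[OF tendsto_const] filterlim_real_sequentially) auto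
    then have "\<forall>\<^sub>F t in sequentially. 2 * X + 2 \<le> real t * sqrt d"
      by (simp add: filterlim_at_top)
    then show ?thesis using eventually_gt_at_top[of 0] by eventually_elim (rule bound)
  qed
  ultimately show ?thesis
    using tendsto_lowerbound[of _ "2 / X + 0" sequentially] by simp
qed

text \<open>The normalised sum does not change when \<open>d\<close> is multiplied by a square, so it equals its limit
  along \<open>d t\<^sup>2\<close>; the limit is the Fresnel integral for every \<open>d\<close>, and \<open>d = 2\<close> gives its value.\<close>

theorem quad_gauss_eq:
  assumes "even d" "d > 0"
  shows "quad_gauss d = sqrt d * cis (pi / 4)"
proof -
  let ?c = "\<lambda>d. quad_gauss d / complex_of_real (sqrt (real d))"
  have "norm (?c d - ?c 2) \<le> e" if "e > 0" for e
  proof -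
    \<comment> \<open>The cutoff \<open>4 / e\<close> turns the error \<open>2 / X\<close> into
      \<open>e / 2\<close>.\<close>
    have "norm (?c d - 2 * fresnel (4 / e)) \<le> e / 2" "norm (?c 2 - 2 * fresnel (4 / e)) \<le> e / 2"
      using quad_gauss_near_fresnel[of d "4 / e"] quad_gauss_near_fresnel[of 2 "4 / e"] assms that by auto
    then show ?thesis
      using norm_triangle_ineq4[of "?c d - 2 * fresnel (4 / e)" "?c 2 - 2 * fresnel (4 / e)"] by simp
  qed
  then have "norm (?c d - ?c 2) \<le> 0" by (metis field_le_epsilon add_0)
  then have "?c d = ?c 2" by simp
  also have "quad_gauss 2 = 1 + \<i>"
    by (simp add: quad_gauss_def numeral_2_eq_2 chirp_def cis_pi_half[simplified])
  also have "(1 + \<i>) / complex_of_real (sqrt (real 2)) = cis (pi / 4)"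
    by (simp add: complex_eq_iff cos_45 sin_45 real_div_sqrt field_simps)
  finally show ?thesis using assms by (simp add: field_simps)
qed

section \<open>Gauss sums on finite quotients\<close>

definition add_subgroup :: "'a::ab_group_add set \<Rightarrow> bool" where
  "add_subgroup A \<longleftrightarrow> 0 \<in> A \<and> (\<forall>x\<in>A. \<forall>y\<in>A. x - y \<in> A)"

lemma add_subgroupD:
  assumes "add_subgroup A"
  shows "0 \<in> A" "x \<in> A \<Longrightarrow> y \<in> A \<Longrightarrow> x - y \<in> A" "x \<in> A \<Longrightarrow> - x \<in> A"
    "x \<in> A \<Longrightarrow> y \<in> A \<Longrightarrow> x + y \<in> A"
proof -
  show 0: "0 \<in> A" and d: "x \<in> A \<Longrightarrow> y \<in> A \<Longrightarrow> x - y \<in> A" for x y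
    using assms by (auto simp: add_subgroup_def)
  show n: "x \<in> A \<Longrightarrow> - x \<in> A" for x using d[OF 0] by simp
  show "x \<in> A \<Longrightarrow> y \<in> A \<Longrightarrow> x + y \<in> A" using d[of x "- y"] n by simp
qed

definition transversal :: "'a::ab_group_add set \<Rightarrow> 'a set \<Rightarrow> 'a set \<Rightarrow> bool" where
  "transversal A L R \<longleftrightarrow> R \<subseteq> A \<and> (\<forall>x\<in>A. \<exists>!r. r \<in> R \<and> x - r \<in> L)"

text \<open>The representatives are chosen as in the numerator of \<open>gamma\<close>, so that
  \<open>gamma\<close> unfolds to this sum. For \<open>h\<close> invariant under \<open>L\<close>
  every transversal yields the same value.\<close>

definition csum :: "'a::ab_group_add set \<Rightarrow> 'a set \<Rightarrow> ('a \<Rightarrow> complex) \<Rightarrow> complex" where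
  "csum A L h = (\<Sum>C\<in>cosets A L. h (SOME x. x \<in> C))"

lemma mem_coset_iff: "y \<in> (\<lambda>l. x + l) ` L \<longleftrightarrow> y - x \<in> (L :: 'a::ab_group_add set)"
  by (force simp: image_iff)

lemma coset_eq_iff:
  assumes "add_subgroup L"
  shows "(\<lambda>l. x + l) ` L = (\<lambda>l. y + l) ` L \<longleftrightarrow> x - y \<in> L"
proof
  assume "(\<lambda>l. x + l) ` L = (\<lambda>l. y + l) ` L"
  moreover have "x \<in> (\<lambda>l. x + l) ` L" using add_subgroupD(1)[OF assms] by (simp add: mem_coset_iff)
  ultimately show "x - y \<in> L" using mem_coset_iff by blast
next
  assume "x - y \<in> L"
  then have "z - x \<in> L \<longleftrightarrow> z - y \<in> L" for z
    using add_subgroupD(2,4)[OF assms, of "z - x" "x - y"] add_subgroupD(2)[OF assms, of "z - y" "x - y"] by auto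
  then show "(\<lambda>l. x + l) ` L = (\<lambda>l. y + l) ` L"
    by (intro set_eqI) (simp add: mem_coset_iff)
qed

lemma some_mem_coset:
  assumes "add_subgroup L"
  shows "(SOME y. y \<in> (\<lambda>l. x + l) ` L) \<in> (\<lambda>l. x + l) ` L"
  by (rule someI[of _ x]) (simp add: mem_coset_iff add_subgroupD(1)[OF assms])

lemma transversal_unique:
  assumes "add_subgroup L" "transversal A L R" "r \<in> R" "r' \<in> R" "r - r' \<in> L"
  shows "r = r'"
proof -
  have "\<exists>!s. s \<in> R \<and> r - s \<in> L" using assms(2,3) by (auto simp: transversal_def)
  moreover have "r - r \<in> L" using add_subgroupD(1)[OF assms(1)] by simp
  ultimately show ?thesis using assms(3-5) by blast
qed

lemma transversal_bij_betw:
  assumes "add_subgroup L" "transversal A L R"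
  shows "bij_betw (\<lambda>x. (\<lambda>l. x + l) ` L) R (cosets A L)"
  unfolding bij_betw_def
proof
  show "inj_on (\<lambda>x. (\<lambda>l. x + l) ` L) R"
  proof (rule inj_onI)
    fix x y assume xy: "x \<in> R" "y \<in> R" "(\<lambda>l. x + l) ` L = (\<lambda>l. y + l) ` L"
    then have "x - y \<in> L" "x - x \<in> L" "x \<in> A"
      using coset_eq_iff[OF assms(1)] add_subgroupD(1)[OF assms(1)] assms(2) by (auto simp: transversal_def)
    then show "x = y" using xy assms(2) unfolding transversal_def by blast
  qed
  show "(\<lambda>x. (\<lambda>l. x + l) ` L) ` R = cosets A L"
  proof
    show "(\<lambda>x. (\<lambda>l. x + l) ` L) ` R \<subseteq> cosets A L"
      using assms(2) by (auto simp: cosets_def transversal_def)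
    show "cosets A L \<subseteq> (\<lambda>x. (\<lambda>l. x + l) ` L) ` R"
    proof
      fix C assume "C \<in> cosets A L"
      then obtain x where x: "x \<in> A" "C = (\<lambda>l. x + l) ` L" by (auto simp: cosets_def)
      then obtain r where "r \<in> R" "x - r \<in> L" using assms(2) unfolding transversal_def by blast
      then show "C \<in> (\<lambda>x. (\<lambda>l. x + l) ` L) ` R" using x coset_eq_iff[OF assms(1)] by blast
    qed
  qed
qed

lemma transversal_finite_iff:
  assumes "add_subgroup L" "transversal A L R"
  shows "finite (cosets A L) \<longleftrightarrow> finite R"
  using bij_betw_finite[OF transversal_bij_betw[OF assms]] by simp

lemma card_cosets_transversal:
  assumes "add_subgroup L" "transversal A L R"
  shows "card (cosets A L) = card R"
  using bij_betw_same_card[OF transversal_bij_betw[OF assms]] by simp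

lemma csum_transversal:
  assumes "add_subgroup L" "transversal A L R"
    and inv: "\<And>x l. x \<in> A \<Longrightarrow> l \<in> L \<Longrightarrow> h (x + l) = h x"
  shows "csum A L h = (\<Sum>r\<in>R. h r)"
proof -
  have "csum A L h = (\<Sum>r\<in>R. h (SOME x. x \<in> (\<lambda>l. r + l) ` L))"
    unfolding csum_def by (rule sum.reindex_bij_betw[symmetric, OF transversal_bij_betw[OF assms(1,2)]])
  also have "\<dots> = (\<Sum>r\<in>R. h r)"
  proof (rule sum.cong[OF refl])
    fix r assume "r \<in> R"
    have "(SOME x. x \<in> (\<lambda>l. r + l) ` L) \<in> (\<lambda>l. r + l) ` L"
      by (rule some_mem_coset[OF assms(1)])
    then show "h (SOME x. x \<in> (\<lambda>l. r + l) ` L) = h r"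
      using inv \<open>r \<in> R\<close> assms(2) by (auto simp: transversal_def)
  qed
  finally show ?thesis .
qed

lemma ex_transversal:
  assumes "add_subgroup A" "add_subgroup L" "L \<subseteq> A"
  obtains R where "transversal A L R"
proof
  define rep where "rep x = (SOME y. y \<in> (\<lambda>l. x + l) ` L)" for x
  have rep: "rep x - x \<in> L" for x
    using some_mem_coset[OF assms(2), of x] by (simp add: rep_def mem_coset_iff)
  have rep_eq: "rep x = rep y" if "x - y \<in> L" for x y
    using that coset_eq_iff[OF assms(2), of x y] by (simp add: rep_def)
  show "transversal A L (rep ` A)"
    unfolding transversal_def
  proof (intro conjI ballI)
    show "rep ` A \<subseteq> A"
    proof clarify
      fix x assume "x \<in> A"
      then have "(rep x - x) + x \<in> A"
        using rep assms(3) by (intro add_subgroupD(4)[OF assms(1)]) auto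
      then show "rep x \<in> A" by simp
    qed
    fix x assume x: "x \<in> A"
    show "\<exists>!r. r \<in> rep ` A \<and> x - r \<in> L"
    proof
      show "rep x \<in> rep ` A \<and> x - rep x \<in> L"
        using x add_subgroupD(3)[OF assms(2) rep, of x] by simp
      fix r assume "r \<in> rep ` A \<and> x - r \<in> L"
      then obtain y where y: "r = rep y" "x - rep y \<in> L" by auto
      have "x - y \<in> L" using add_subgroupD(4)[OF assms(2) y(2) rep[of y]] by simp
      then show "r = rep x" using rep_eq y by simp
    qed
  qed
qed

lemma transversal_translate:
  assumes "add_subgroup A" "transversal A L R" "y \<in> A"
  shows "transversal A L ((\<lambda>r. r + y) ` R)"
  unfolding transversal_def
proof (intro conjI ballI)
  show "(\<lambda>r. r + y) ` R \<subseteq> A"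
    using assms add_subgroupD(4)[OF assms(1)] by (auto simp: transversal_def)
  fix x assume "x \<in> A"
  then have "x - y \<in> A" using assms add_subgroupD by blast
  then obtain r where r: "r \<in> R" "x - y - r \<in> L" "\<And>r'. r' \<in> R \<Longrightarrow> x - y - r' \<in> L \<Longrightarrow> r' = r"
    using assms(2) unfolding transversal_def by metis
  show "\<exists>!r. r \<in> (\<lambda>r. r + y) ` R \<and> x - r \<in> L"
  proof
    show "r + y \<in> (\<lambda>r. r + y) ` R \<and> x - (r + y) \<in> L"
      using r by (metis imageI diff_diff_add add.commute)
    fix t assume "t \<in> (\<lambda>r. r + y) ` R \<and> x - t \<in> L"
    then obtain r' where r': "t = r' + y" "r' \<in> R" "x - (r' + y) \<in> L" by auto
    then have "x - y - r' \<in> L" by (metis diff_diff_add add.commute)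
    then show "t = r + y" using r(3) r' by simp
  qed
qed

text \<open>A translate of a transversal by an element of \<open>A\<close> is again a transversal,
  and an \<open>L\<close>-invariant function has the same sum over both.\<close>

lemma sum_translate_transversal:
  assumes "add_subgroup A" "add_subgroup L" "transversal A L R" "y \<in> A"
    and "\<And>x l. x \<in> A \<Longrightarrow> l \<in> L \<Longrightarrow> h (x + l) = h x"
  shows "(\<Sum>r\<in>R. h (r + y)) = (\<Sum>r\<in>R. h r :: complex)"
proof -
  have "(\<Sum>r\<in>R. h (r + y)) = (\<Sum>r\<in>(\<lambda>r. r + y) ` R. h r)"
    by (simp add: sum.reindex)
  also have "\<dots> = csum A L h"
    using csum_transversal[OF assms(2) transversal_translate[OF assms(1,3,4)] assms(5)] by simp
  also have "\<dots> = (\<Sum>r\<in>R. h r)"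
    using csum_transversal[OF assms(2,3,5)] by simp
  finally show ?thesis .
qed

text \<open>The last hypothesis makes \<open>B\<close> a union of cosets of \<open>L\<close> in
  \<open>A\<close>. This allows the sum over an orthogonal complement to be taken as a part of the
  sum over \<open>A\<close>.\<close>

lemma transversal_saturated_subset:
  assumes "transversal A L R" "B \<subseteq> A" and "\<And>x y. y \<in> B \<Longrightarrow> x \<in> A \<Longrightarrow> y - x \<in> L \<Longrightarrow> x \<in> B"
  shows "transversal B L (R \<inter> B)"
  unfolding transversal_def
proof (intro conjI ballI)
  fix x assume x: "x \<in> B"
  then obtain r where r: "r \<in> R" "x - r \<in> L" "\<And>r'. r' \<in> R \<Longrightarrow> x - r' \<in> L \<Longrightarrow> r' = r"
    using assms(1,2) unfolding transversal_def by (metis subsetD)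
  moreover have "r \<in> A" using assms(1) r(1) unfolding transversal_def by blast
  then have "r \<in> B" by (rule assms(3)[OF x _ r(2)])
  ultimately show "\<exists>!r. r \<in> R \<inter> B \<and> x - r \<in> L" by blast
qed auto

text \<open>\<open>A / L\<close> fibres over \<open>A / M\<close> with fibre \<open>M / L\<close>:
  the \<open>M\<close>-part of an element determines \<open>r\<close>, and what remains lies in
  \<open>M\<close> and determines \<open>s\<close>.\<close>

lemma transversal_tower:
  assumes sA: "add_subgroup A" "add_subgroup M" "add_subgroup L" "M \<subseteq> A" "L \<subseteq> M"
    and R: "transversal A M R" and S: "transversal M L S"
  shows "transversal A L ((\<lambda>(r, s). r + s) ` (R \<times> S))" "inj_on (\<lambda>(r, s). r + s) (R \<times> S)"
proof -
  have RS: "R \<subseteq> A" "S \<subseteq> M" using R S by (auto simp: transversal_def)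
  have uniq: "r = r' \<and> s = s'"
    if "r \<in> R" "r' \<in> R" "s \<in> S" "s' \<in> S" "(r + s) - (r' + s') \<in> L" for r r' s s'
  proof -
    have ss: "s \<in> M" "s' \<in> M" using that RS by auto
    have "((r + s) - (r' + s')) - (s - s') \<in> M"
      by (rule add_subgroupD(2)[OF sA(2) subsetD[OF sA(5) that(5)] add_subgroupD(2)[OF sA(2) ss]])
    then have "r - r' \<in> M" by (simp add: algebra_simps)
    then have r: "r = r'" by (rule transversal_unique[OF sA(2) R that(1,2)])
    then have "s - s' \<in> L" using that(5) by simp
    then show ?thesis using r transversal_unique[OF sA(3) S that(3,4)] by simp
  qed
  show "inj_on (\<lambda>(r, s). r + s) (R \<times> S)"
  proof (rule inj_onI, clarify)
    fix r s r' s' assume "r \<in> R" "s \<in> S" "r' \<in> R" "s' \<in> S" "r + s = r' + s'"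
    then show "r = r' \<and> s = s'" using uniq[of r r' s s'] add_subgroupD(1)[OF sA(3)] by simp
  qed
  show "transversal A L ((\<lambda>(r, s). r + s) ` (R \<times> S))"
    unfolding transversal_def
  proof (intro conjI ballI)
    show "(\<lambda>(r, s). r + s) ` (R \<times> S) \<subseteq> A"
      using RS sA(4) add_subgroupD(4)[OF sA(1)] by (auto simp: subset_iff)
    fix x assume "x \<in> A"
    then obtain r where r: "r \<in> R" "x - r \<in> M" using R unfolding transversal_def by metis
    then obtain s where s: "s \<in> S" "x - r - s \<in> L" using S unfolding transversal_def by metis
    show "\<exists>!t. t \<in> (\<lambda>(r, s). r + s) ` (R \<times> S) \<and> x - t \<in> L"
    proof
      show "r + s \<in> (\<lambda>(r, s). r + s) ` (R \<times> S) \<and> x - (r + s) \<in> L"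
        using r s by (auto simp: diff_diff_add intro!: rev_image_eqI[of "(r, s)"])
      fix t assume "t \<in> (\<lambda>(r, s). r + s) ` (R \<times> S) \<and> x - t \<in> L"
      then obtain r' s' where t: "t = r' + s'" "r' \<in> R" "s' \<in> S" "x - t \<in> L" by auto
      have "(x - r - s) - (x - t) \<in> L" by (rule add_subgroupD(2)[OF sA(3) s(2) t(4)])
      then have "(r' + s') - (r + s) \<in> L" using t(1) by (simp add: algebra_simps)
      then show "t = r + s" using uniq[OF t(2) r(1) t(3) s(1)] t(1) by simp
    qed
  qed
qed

lemma csum_tower:
  assumes "add_subgroup A" "add_subgroup M" "add_subgroup L" "M \<subseteq> A" "L \<subseteq> M"
    and inv: "\<And>x l. x \<in> A \<Longrightarrow> l \<in> M \<Longrightarrow> h (x + l) = h x"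
  shows "csum A L h = of_nat (card (cosets M L)) * csum A M h"
proof -
  obtain R where R: "transversal A M R" using ex_transversal assms by blast
  obtain S where S: "transversal M L S" using ex_transversal assms by blast
  note tow = transversal_tower[OF assms(1-5) R S]
  have "csum A L h = (\<Sum>t\<in>(\<lambda>(r, s). r + s) ` (R \<times> S). h t)"
    using assms by (intro csum_transversal[OF assms(3) tow(1)]) auto
  also have "\<dots> = (\<Sum>r\<in>R. \<Sum>s\<in>S. h (r + s))"
    by (subst sum.reindex[OF tow(2)]) (simp add: sum.cartesian_product case_prod_beta' comp_def)
  also have "\<dots> = (\<Sum>r\<in>R. of_nat (card S) * h r)"
    using R S inv by (auto intro!: sum.cong simp: transversal_def subset_iff)
  also have "\<dots> = of_nat (card (cosets M L)) * csum A M h"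
    using csum_transversal[OF assms(2) R inv] card_cosets_transversal[OF assms(3) S]
    by (simp add: sum_distrib_left)
  finally show ?thesis .
qed

lemma cosets_mono: "H \<subseteq> A \<Longrightarrow> cosets H L \<subseteq> cosets A L"
  by (auto simp: cosets_def)

lemma finite_cosets_coarser:
  assumes "add_subgroup A" "add_subgroup M" "add_subgroup L" "M \<subseteq> A" "L \<subseteq> M" "finite (cosets A L)"
  shows "finite (cosets A M)"
proof -
  obtain R where R: "transversal A L R" using ex_transversal assms by blast
  have "cosets A M \<subseteq> (\<lambda>x. (\<lambda>l. x + l) ` M) ` R"
  proof
    fix C assume "C \<in> cosets A M"
    then obtain x where x: "x \<in> A" "C = (\<lambda>l. x + l) ` M" by (auto simp: cosets_def)
    then obtain r where "r \<in> R" "x - r \<in> L" using R unfolding transversal_def by blast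
    then show "C \<in> (\<lambda>x. (\<lambda>l. x + l) ` M) ` R" using x assms(5) coset_eq_iff[OF assms(2)] by blast
  qed
  moreover have "finite R" using transversal_finite_iff[OF assms(3) R] assms(6) by simp
  ultimately show ?thesis by (meson finite_imageI finite_subset)
qed

lemma card_cosets_pos:
  assumes "finite (cosets A L)" "A \<noteq> {}" shows "card (cosets A L) > 0"
  using assms by (simp add: card_gt_0_iff cosets_def)

section \<open>Quadratic functions on a finite quotient\<close>

definition ee :: "rat \<Rightarrow> complex" where
  "ee r = exp (2 * of_real pi * \<i> * of_rat r)"

lemma complex_of_rat: "of_rat r = complex_of_real (of_rat r)"
  by (cases r) (simp add: of_rat_rat)

lemma ee_conv_cis: "ee r = cis (2 * pi * of_rat r)"
  by (simp add: ee_def cis_conv_exp ac_simps complex_of_rat)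

lemma ee_add: "ee (r + s) = ee r * ee s"
  by (simp add: ee_conv_cis cis_mult of_rat_add algebra_simps)

lemma ee_eq_1_iff: "ee r = 1 \<longleftrightarrow> r \<in> \<int>"
proof
  assume "ee r = 1"
  then have "cos (2 * pi * of_rat r) = 1" by (simp add: ee_conv_cis complex_eq_iff)
  then obtain n :: int where "2 * pi * of_rat r = of_int n * 2 * pi" using cos_one_2pi_int by blast
  then have "of_rat r = (of_rat (of_int n) :: real)" by simp
  then show "r \<in> \<int>" by (simp only: of_rat_eq_iff Ints_of_int)
next
  assume "r \<in> \<int>"
  then obtain n where "r = of_int n" by (elim Ints_cases)
  then show "ee r = 1" using cis_multiple_2pi[of "of_int n"] by (simp add: ee_conv_cis)
qed

lemma cnj_ee: "cnj (ee r) = ee (- r)" by (simp add: ee_conv_cis cis_cnj of_rat_minus)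

lemma gamma_csum:
  "gamma A L q = csum A L (\<lambda>x. ee (q x)) / (of_real (sqrt (card (cosets A L))) * of_real (sqrt (card (qperp A L q))))"
  by (simp add: gamma_def csum_def ee_def)

text \<open>A rational lift of a quadratic function on the finite group \<open>A / L\<close>. The
  identities for \<open>q\<close> and \<open>b\<close> hold exactly and on the whole ambient group;
  \<open>b_L\<close> and \<open>q_L\<close> make \<open>q\<close> modulo \<open>\<int>\<close>
  constant on the cosets of \<open>L\<close> in \<open>A\<close>.\<close>

locale quadratic_cosets =
  fixes A L :: "'a::ab_group_add set" and q :: "'a \<Rightarrow> rat" and b :: "'a \<Rightarrow> 'a \<Rightarrow> rat"
  assumes subgroup_A: "add_subgroup A" and subgroup_L: "add_subgroup L" and L_subset: "L \<subseteq> A"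
    and finite_cosets: "finite (cosets A L)"
    and q_add: "q (x + y) = q x + q y + b x y"
    and b_add: "b x (y + y') = b x y + b x y'"
    and b_sym: "b x y = b y x"
    and b_L: "x \<in> A \<Longrightarrow> l \<in> L \<Longrightarrow> b x l \<in> \<int>"
    and q_L: "l \<in> L \<Longrightarrow> q l \<in> \<int>"
begin

definition gsum :: "'a set \<Rightarrow> complex" where
  "gsum H = csum H L (\<lambda>x. ee (q x))"

definition perp :: "'a set \<Rightarrow> 'a set" where
  "perp H = {x \<in> A. \<forall>y\<in>H. b x y \<in> \<int>}"

lemma ee_q_invariant: "x \<in> A \<Longrightarrow> l \<in> L \<Longrightarrow> ee (q (x + l)) = ee (q x)"
  using b_L[of x l] q_L[of l] by (simp add: q_add ee_add flip: ee_eq_1_iff)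

lemma b_add_left: "b (x + x') y = b x y + b x' y"
  using b_add b_sym by metis

lemma b_0: "b x 0 = 0" "b 0 x = 0"
  using b_add[of x 0 0] b_add_left[of 0 0 x] by auto

lemma b_diff: "b x (y - z) = b x y - b x z" "b (y - z) x = b y x - b z x"
proof -
  show "b x (y - z) = b x y - b x z" for x using b_add[of x "y - z" z] by simp
  then show "b (y - z) x = b y x - b z x" using b_sym by metis
qed

lemma subgroup_perp: "add_subgroup (perp H)"
  using add_subgroupD(1,2)[OF subgroup_A]
  by (auto simp: add_subgroup_def perp_def b_diff b_0 intro!: Ints_diff)

lemma finite_cosets_subset: "H \<subseteq> A \<Longrightarrow> finite (cosets H L)"
  using cosets_mono finite_cosets finite_subset by metis

text \<open>Orthogonality of characters: translation by an element at which the character is not 1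
  multiplies the sum by that value, so the sum vanishes.\<close>

lemma sum_character:
  assumes "add_subgroup H" "L \<subseteq> H" "H \<subseteq> A" "transversal H L R" "x \<in> A"
  shows "(\<Sum>y\<in>R. ee (b x y)) = (if \<forall>y\<in>H. b x y \<in> \<int> then of_nat (card R) else 0)"
proof (cases "\<forall>y\<in>H. b x y \<in> \<int>")
  case True
  then have "(\<Sum>y\<in>R. ee (b x y)) = (\<Sum>y\<in>R. 1)"
    using assms(4) by (intro sum.cong refl) (auto simp: transversal_def ee_eq_1_iff)
  then show ?thesis using True by simp
next
  case False
  then obtain y0 where y0: "y0 \<in> H" "ee (b x y0) \<noteq> 1" using ee_eq_1_iff by blast
  have "(\<Sum>y\<in>R. ee (b x y)) = (\<Sum>y\<in>R. ee (b x (y + y0)))"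
    using assms(5) b_L by (intro sum_translate_transversal[OF assms(1) subgroup_L assms(4) y0(1), symmetric])
      (auto simp: b_add ee_add ee_eq_1_iff)
  also have "\<dots> = (\<Sum>y\<in>R. ee (b x y)) * ee (b x y0)"
    by (simp add: b_add ee_add sum_distrib_right)
  finally have "(\<Sum>y\<in>R. ee (b x y)) = 0" using y0 by simp
  then show ?thesis using False by (simp only: if_False)
qed

text \<open>In the double sum over \<open>r\<close> and \<open>s\<close>, \<open>r\<close> is
  replaced by \<open>r + s\<close>. The exponent \<open>q (r + s) - q s\<close> equals
  \<open>q r + b r s\<close>, and the character sum over \<open>s\<close> retains only those
  \<open>r\<close> that lie in \<open>perp H\<close>.\<close>

lemma gsum_mult_cnj:
  assumes H: "add_subgroup H" "L \<subseteq> H" "H \<subseteq> A"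
  shows "gsum A * cnj (gsum H) = of_nat (card (cosets H L)) * gsum (perp H)"
proof -
  obtain R where R: "transversal A L R" using ex_transversal[OF subgroup_A subgroup_L L_subset] .
  obtain S where S: "transversal H L S" using ex_transversal[OF H(1) subgroup_L H(2)] .
  have finR: "finite R" using transversal_finite_iff[OF subgroup_L R] finite_cosets by simp
  have RA: "R \<subseteq> A" and SA: "S \<subseteq> A" using R S H by (auto simp: transversal_def)
  have gA: "gsum A = (\<Sum>r\<in>R. ee (q r))"
    unfolding gsum_def by (rule csum_transversal[OF subgroup_L R]) (rule ee_q_invariant)
  have gH: "gsum H = (\<Sum>s\<in>S. ee (q s))"
    unfolding gsum_def using H ee_q_invariant by (intro csum_transversal[OF subgroup_L S]) auto
  have "transversal (perp H) L (R \<inter> perp H)"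
  proof (rule transversal_saturated_subset[OF R])
    fix x y assume xy: "y \<in> perp H" "x \<in> A" "y - x \<in> L"
    have "b x z \<in> \<int>" if "z \<in> H" for z
    proof -
      have "b z (y - x) \<in> \<int>" using that H xy by (intro b_L) auto
      then have "b y z - b x z \<in> \<int>" by (metis b_sym b_diff(2))
      moreover have "b y z \<in> \<int>" using that xy by (simp add: perp_def)
      ultimately show ?thesis using Ints_diff[of "b y z" "b y z - b x z"] by simp
    qed
    then show "x \<in> perp H" using xy by (simp add: perp_def)
  qed (auto simp: perp_def)
  then have gP: "gsum (perp H) = (\<Sum>r\<in>R \<inter> perp H. ee (q r))"
    unfolding gsum_def using ee_q_invariant by (intro csum_transversal[OF subgroup_L]) (auto simp: perp_def)
  have tr: "(\<Sum>r\<in>R. ee (q (r + s))) = gsum A" if "s \<in> S" for s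
    unfolding gA using that SA by (intro sum_translate_transversal[OF subgroup_A subgroup_L R] ee_q_invariant) auto
  have "gsum A * cnj (gsum H) = (\<Sum>s\<in>S. (\<Sum>r\<in>R. ee (q (r + s))) * ee (- q s))"
    using tr by (simp add: gH sum_distrib_left cnj_ee)
  also have "\<dots> = (\<Sum>s\<in>S. \<Sum>r\<in>R. ee (q r) * ee (b r s))"
    by (simp add: sum_distrib_right q_add flip: ee_add)
  also have "\<dots> = (\<Sum>r\<in>R. ee (q r) * (\<Sum>s\<in>S. ee (b r s)))"
    by (subst sum.swap) (simp add: sum_distrib_left)
  also have "\<dots> = (\<Sum>r\<in>R. if r \<in> perp H then of_nat (card S) * ee (q r) else 0)"
  proof (intro sum.cong refl)
    fix r assume "r \<in> R"
    then have "r \<in> A" using RA by blast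
    then show "ee (q r) * (\<Sum>s\<in>S. ee (b r s)) = (if r \<in> perp H then of_nat (card S) * ee (q r) else 0)"
      using sum_character[OF H S, of r] by (simp add: perp_def)
  qed
  also have "\<dots> = (\<Sum>r\<in>R \<inter> perp H. of_nat (card S) * ee (q r))"
    using finR by (simp add: sum.inter_restrict)
  finally show ?thesis
    by (simp add: gP sum_distrib_left card_cosets_transversal[OF subgroup_L S])
qed

lemma gsum_eq_card:
  assumes H: "add_subgroup H" "L \<subseteq> H" "H \<subseteq> A" and "\<And>x. x \<in> H \<Longrightarrow> q x \<in> \<int>"
  shows "gsum H = of_nat (card (cosets H L))"
proof -
  obtain S where S: "transversal H L S" using ex_transversal[OF H(1) subgroup_L H(2)] .
  have "gsum H = (\<Sum>s\<in>S. ee (q s))"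
    unfolding gsum_def using H ee_q_invariant by (intro csum_transversal[OF subgroup_L S]) auto
  also have "\<dots> = (\<Sum>s\<in>S. 1)"
    using S assms(4) by (intro sum.cong refl) (auto simp: transversal_def ee_eq_1_iff)
  finally show ?thesis by (simp add: card_cosets_transversal[OF subgroup_L S])
qed

text \<open>On the isotropic subgroup \<open>M / L\<close> the Gauss sum is its order, so the
  product formula reduces the sum over \<open>A\<close> to \<open>perp M\<close>, where
  \<open>q\<close> modulo \<open>\<int>\<close> is constant on cosets of \<open>M\<close>. Thus the
  phase can be computed from a sublattice.\<close>

lemma gsum_coarser_lattice:
  assumes M: "add_subgroup M" "L \<subseteq> M" "M \<subseteq> A" "M \<subseteq> perp M" and qM: "\<And>x. x \<in> M \<Longrightarrow> q x \<in> \<int>"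
  shows "gsum A = of_nat (card (cosets M L)) * csum (perp M) M (\<lambda>x. ee (q x))"
proof -
  have "card (cosets M L) > 0"
    using add_subgroupD(1)[OF M(1)] by (intro card_cosets_pos finite_cosets_subset M) auto
  then have "gsum A = gsum (perp M)"
    using gsum_mult_cnj[OF M(1-3)] gsum_eq_card[OF M(1-3) qM] by simp
  also have "\<dots> = of_nat (card (cosets M L)) * csum (perp M) M (\<lambda>x. ee (q x))"
    unfolding gsum_def
  proof (rule csum_tower[OF subgroup_perp M(1) subgroup_L M(4,2)])
    fix x l assume "x \<in> perp M" "l \<in> M"
    then show "ee (q (x + l)) = ee (q x)"
      using qM[of l] by (simp add: q_add ee_add perp_def flip: ee_eq_1_iff)
  qed
  finally show ?thesis .
qed

text \<open>The radical of \<open>q\<close> on \<open>H / L\<close> is symmetric in \<open>H\<close>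
  and its complement. For two subgroups that are each other's complements the radical factors in
  \<open>gamma\<close> therefore agree.\<close>

lemma qperp_eq:
  assumes "H \<subseteq> A"
  shows "qperp H L q = cosets (H \<inter> perp H) L"
proof -
  have L0: "0 \<in> L" using subgroup_L by (rule add_subgroupD)
  have b_coset: "b (x + l) (y + l') \<in> \<int> \<longleftrightarrow> b x y \<in> \<int>" if "x \<in> A" "y \<in> A" "l \<in> L" "l' \<in> L" for x y l l'
  proof -
    have i: "b x l' + b y l + b l l' \<in> \<int>" using that L_subset by (intro Ints_add b_L) auto
    have "b (x + l) (y + l') = b x y + (b x l' + b y l + b l l')"
      using b_sym[of y l] by (simp add: b_add b_add_left)
    then show ?thesis using i by (metis Ints_add Ints_diff add_diff_cancel_right')
  qed
  have q2: "q (x + y) - q x - q y = b x y" for x y by (simp add: q_add)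
  show ?thesis
  proof (intro equalityI subsetI)
    fix C assume C: "C \<in> qperp H L q"
    then obtain x where x: "x \<in> H" "C = (\<lambda>l. x + l) ` L" by (auto simp: qperp_def cosets_def)
    have "b x y \<in> \<int>" if "y \<in> H" for y
    proof -
      have "x \<in> C" "y \<in> (\<lambda>l. y + l) ` L" "(\<lambda>l. y + l) ` L \<in> cosets H L"
        using x L0 that by (auto simp: mem_coset_iff cosets_def)
      then show ?thesis using C by (auto simp: qperp_def q2)
    qed
    then show "C \<in> cosets (H \<inter> perp H) L" using x assms by (auto simp: cosets_def perp_def)
  next
    fix C assume "C \<in> cosets (H \<inter> perp H) L"
    then obtain x where x: "x \<in> H" "\<And>y. y \<in> H \<Longrightarrow> b x y \<in> \<int>" "C = (\<lambda>l. x + l) ` L"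
      by (auto simp: cosets_def perp_def)
    then show "C \<in> qperp H L q"
      using assms by (auto simp: qperp_def q2 cosets_def b_coset subset_iff)
  qed
qed

theorem gamma_reciprocity:
  assumes H: "add_subgroup H" "L \<subseteq> H" "H \<subseteq> A" and K: "add_subgroup K" "L \<subseteq> K" "K \<subseteq> A"
    and perp: "perp K = H" "perp H = K" "perp A = L"
    and phase: "gsum A = of_real r * u" "r > 0" "norm u = 1"
  shows "gamma H L q = u * cnj (gamma K L q)"
proof -
  let ?a = "card (cosets A L)" and ?h = "card (cosets H L)" and ?k = "card (cosets K L)"
  have pos: "?h > 0" "?k > 0"
    using add_subgroupD(1)[OF H(1)] add_subgroupD(1)[OF K(1)]
    by (auto intro!: card_cosets_pos finite_cosets_subset H K)
  \<comment> \<open>Because \<open>perp A = L\<close> and \<open>gsum L = 1\<close>, the product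
    formula for \<open>A\<close> itself determines the absolute value of
    \<open>gsum A\<close>.\<close>
  have "gsum L = of_nat (card (cosets L L))"
    using q_L by (intro gsum_eq_card subgroup_L L_subset) auto
  also have "cosets L L = {L}"
  proof -
    have "(\<lambda>l. x + l) ` L = L" if "x \<in> L" for x
      using coset_eq_iff[OF subgroup_L, of x 0] that by simp
    then show ?thesis using add_subgroupD(1)[OF subgroup_L] by (auto simp: cosets_def)
  qed
  finally have AA: "gsum A * cnj (gsum A) = of_nat ?a"
    using gsum_mult_cnj[OF subgroup_A L_subset order_refl] perp(3) by simp
  have "gsum A * cnj (gsum A) = of_real (r\<^sup>2)"
    using phase unfolding complex_norm_square[symmetric] by (simp add: norm_mult power_mult_distrib)
  then have ra: "r\<^sup>2 = ?a" using AA by (metis of_real_eq_iff of_real_of_nat_eq)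
  have K1: "gsum A * cnj (gsum K) = of_nat ?k * gsum H" using gsum_mult_cnj[OF K] perp by simp
  have H1: "gsum A * cnj (gsum H) = of_nat ?h * gsum K" using gsum_mult_cnj[OF H] perp by simp
  have gam: "gamma H L q = gsum H / (of_real (sqrt ?h) * of_real (sqrt (card (cosets (H \<inter> K) L))))"
    "gamma K L q = gsum K / (of_real (sqrt ?k) * of_real (sqrt (card (cosets (H \<inter> K) L))))"
    using qperp_eq[OF H(3)] qperp_eq[OF K(3)] perp by (auto simp: gamma_csum gsum_def Int_commute)
  show ?thesis
  \<comment> \<open>The index formula \<open>?a = ?k * ?h\<close> comes from applying the product
    formula twice and cancelling \<open>gsum K\<close>. If that sum is 0, then so is
    \<open>gsum H\<close>, and both sides vanish.\<close>
  proof (cases "gsum K = 0")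
    case True
    then have "gsum H = 0" using K1 pos by simp
    then show ?thesis using True gam by simp
  next
    case False
    have "of_nat ?a * gsum K = gsum A * cnj (gsum A * cnj (gsum K))" using AA by simp
    also have "\<dots> = of_nat ?k * (gsum A * cnj (gsum H))" unfolding K1 by simp
    also have "\<dots> = of_nat (?k * ?h) * gsum K" unfolding H1 by simp
    finally have "?a = ?k * ?h" using False by (simp only: mult_cancel_right of_nat_eq_iff) simp
    then have "r\<^sup>2 = (sqrt ?k * sqrt ?h)\<^sup>2" using ra by (simp add: power_mult_distrib)
    then have r: "r = sqrt ?k * sqrt ?h" using phase(2) by (simp add: power2_eq_iff_nonneg)
    have kk: "complex_of_real (sqrt ?k) * complex_of_real (sqrt ?k) = of_nat ?k"
      by (simp flip: of_real_mult)
    have "complex_of_real (sqrt ?k) * gsum H = u * complex_of_real (sqrt ?h) * cnj (gsum K)"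
    proof -
      have "complex_of_real (sqrt ?k) * (complex_of_real (sqrt ?k) * gsum H) = of_real r * u * cnj (gsum K)"
        using K1 phase(1) kk by (simp add: mult.assoc[symmetric])
      also have "\<dots> = complex_of_real (sqrt ?k) * (u * complex_of_real (sqrt ?h) * cnj (gsum K))"
        by (simp add: r)
      finally show ?thesis using pos by simp
    qed
    then have "gsum H / complex_of_real (sqrt ?h) = u * (cnj (gsum K) / complex_of_real (sqrt ?k))"
      using pos by (simp add: field_simps)
    then show ?thesis unfolding gam divide_divide_eq_left[symmetric] by simp
  qed
qed

end

section \<open>Orthogonal bases and the signature\<close>

definition lincomb :: "('k::finite \<Rightarrow> 'n \<Rightarrow> rat) \<Rightarrow> ('k \<Rightarrow> rat) \<Rightarrow> 'n \<Rightarrow> rat" where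
  "lincomb R c = (\<lambda>i. \<Sum>k\<in>UNIV. c k * R k i)"

lemma formQ_add_left: "formQ T (x + y) z = formQ T x z + formQ T y z"
  by (simp add: formQ_def algebra_simps sum.distrib)

lemma formQ_add_right: "formQ T z (x + y) = formQ T z x + formQ T z y"
  by (simp add: formQ_def algebra_simps sum.distrib)

lemma formQ_diff_left: "formQ T (x - y) z = formQ T x z - formQ T y z"
  by (simp add: formQ_def algebra_simps sum_subtractf)

lemma formQ_0_left [simp]: "formQ T 0 z = 0"
  by (simp add: formQ_def)

lemma formQ_scale_left: "formQ T (\<lambda>i. c * x i) y = c * formQ T x y"
  by (simp add: formQ_def sum_distrib_left algebra_simps)

lemma formQ_scale_right: "formQ T x (\<lambda>i. c * y i) = c * formQ T x y"
  by (simp add: formQ_def sum_distrib_left algebra_simps)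

lemma formQ_sym:
  assumes "\<And>i j. T i j = T j i"
  shows "formQ T x y = formQ T y x"
proof -
  have "formQ T x y = (\<Sum>j\<in>UNIV. \<Sum>i\<in>UNIV. x i * of_int (T i j) * y j)"
    unfolding formQ_def by (rule sum.swap)
  also have "\<dots> = formQ T y x"
    unfolding formQ_def
  proof (intro sum.cong refl)
    fix i j show "x i * of_int (T i j) * y j = y j * of_int (T j i) * x i" by (simp add: assms[of i j])
  qed
  finally show ?thesis .
qed

lemma formQ_lincomb_left: "formQ T (lincomb R c) y = (\<Sum>k\<in>UNIV. c k * formQ T (R k) y)"
proof -
  have "formQ T (lincomb R c) y = (\<Sum>i\<in>UNIV. \<Sum>j\<in>UNIV. \<Sum>k\<in>UNIV. c k * (R k i * of_int (T i j) * y j))"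
    by (simp add: formQ_def lincomb_def sum_distrib_right sum_distrib_left mult.assoc)
  also have "\<dots> = (\<Sum>i\<in>UNIV. \<Sum>k\<in>UNIV. \<Sum>j\<in>UNIV. c k * (R k i * of_int (T i j) * y j))"
    by (intro sum.cong refl sum.swap)
  also have "\<dots> = (\<Sum>k\<in>UNIV. \<Sum>i\<in>UNIV. \<Sum>j\<in>UNIV. c k * (R k i * of_int (T i j) * y j))"
    by (rule sum.swap)
  finally show ?thesis by (simp add: formQ_def sum_distrib_left)
qed

lemma Zvec_diff: "x \<in> Zvec \<Longrightarrow> y \<in> Zvec \<Longrightarrow> x - y \<in> Zvec"
  and Zvec_0: "0 \<in> Zvec"
  by (auto simp: Zvec_def)

lemma formQ_Ints: "x \<in> Zvec \<Longrightarrow> y \<in> Zvec \<Longrightarrow> formQ T x y \<in> \<int>"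
  by (auto simp: formQ_def Zvec_def intro!: Ints_sum Ints_mult)

lemma ex_common_denominator:
  fixes x :: "'k::finite \<Rightarrow> rat"
  obtains t :: rat where "t > 0" "\<forall>k. t * x k \<in> \<int>"
proof (rule that)
  define den where "den k = snd (quotient_of (x k))" for k
  have den: "den k > 0" for k unfolding den_def by (rule quotient_of_denom_pos')
  have x: "x k = of_int (fst (quotient_of (x k))) / of_int (den k)" for k
    unfolding den_def by (rule quotient_of_div) simp
  let ?t = "\<Prod>k\<in>UNIV. of_int (den k) :: rat"
  show "?t > 0" using den by (intro prod_pos) auto
  show "\<forall>k. ?t * x k \<in> \<int>"
  proof
    fix k
    have "?t = of_int (den k) * (\<Prod>l\<in>UNIV - {k}. of_int (den l))"
      by (rule prod.remove) auto
    then have "?t * x k = (\<Prod>l\<in>UNIV - {k}. of_int (den l)) * of_int (fst (quotient_of (x k)))"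
      using den[of k] by (subst x) (simp add: field_simps)
    also have "\<dots> \<in> \<int>" by (intro Ints_mult Ints_prod) auto
    finally show "?t * x k \<in> \<int>" .
  qed
qed

text \<open>The index type is that of the coordinates, so the family has as many members as the
  rank; being orthogonal and anisotropic, it is then a basis over \<open>\<rat>\<close>.\<close>

definition orthogonal_basis :: "('n::finite \<Rightarrow> 'n \<Rightarrow> int) \<Rightarrow> ('n \<Rightarrow> 'n \<Rightarrow> rat) \<Rightarrow> ('n \<Rightarrow> rat) \<Rightarrow> bool" where
  "orthogonal_basis T R d \<longleftrightarrow>
     (\<forall>k l. formQ T (R k) (R l) = (if k = l then d k else 0)) \<and> (\<forall>k. d k \<noteq> 0)"

text \<open>With \<open>R\<close> read as a matrix, orthogonality exhibits \<open>T R\<^sup>t D\<^sup>-\<^sup>1\<close> as a right inverse of \<open>R\<close>; that it is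
  also a left inverse is the expansion.\<close>

lemma orthogonal_basis_inverse:
  assumes "orthogonal_basis T R d"
  shows "(\<Sum>k\<in>UNIV. (\<Sum>j\<in>UNIV. of_int (T i j) * R k j) / d k * R k l) = (if i = l then 1 else 0)"
proof -
  define M :: "rat^'a^'a" where "M = (\<chi> k i. R k i)"
  define N :: "rat^'a^'a" where "N = (\<chi> i k. (\<Sum>j\<in>UNIV. of_int (T i j) * R k j) / d k)"
  have "M ** N = mat 1"
  proof -
    have "(M ** N) $ k $ l = (mat 1 :: rat^'a^'a) $ k $ l" for k l
    proof -
      have "(M ** N) $ k $ l = formQ T (R k) (R l) / d l"
        by (simp add: matrix_matrix_mult_def M_def N_def formQ_def sum_divide_distrib sum_distrib_left mult.assoc)
      then show ?thesis using assms by (auto simp: orthogonal_basis_def mat_def)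
    qed
    then show ?thesis by (simp add: vec_eq_iff)
  qed
  then have "N ** M = mat 1" by (simp add: matrix_left_right_inverse)
  then have "(N ** M) $ i $ l = (mat 1 :: rat^'a^'a) $ i $ l" by simp
  then show ?thesis by (simp add: matrix_matrix_mult_def M_def N_def mat_def)
qed

lemma orthogonal_basis_expansion:
  assumes "orthogonal_basis T R d"
  shows "x = lincomb R (\<lambda>k. formQ T x (R k) / d k)"
proof
  fix l
  have "lincomb R (\<lambda>k. formQ T x (R k) / d k) l
      = (\<Sum>k\<in>UNIV. \<Sum>i\<in>UNIV. x i * ((\<Sum>j\<in>UNIV. of_int (T i j) * R k j) / d k * R k l))"
    by (simp add: lincomb_def formQ_def sum_divide_distrib sum_distrib_right sum_distrib_left mult.assoc)
  also have "\<dots> = (\<Sum>i\<in>UNIV. x i * (\<Sum>k\<in>UNIV. (\<Sum>j\<in>UNIV. of_int (T i j) * R k j) / d k * R k l))"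
    by (subst sum.swap) (simp add: sum_distrib_left)
  also have "\<dots> = x l"
    unfolding orthogonal_basis_inverse[OF assms] by (simp add: if_distrib[of "\<lambda>y. _ * y"] cong: if_cong)
  finally show "x l = lincomb R (\<lambda>k. formQ T x (R k) / d k) l" by simp
qed

lemma orthogonal_basis_formQ:
  assumes "orthogonal_basis T R d" "\<And>i j. T i j = T j i"
  shows "formQ T x y = (\<Sum>k\<in>UNIV. formQ T x (R k) * formQ T y (R k) / d k)"
proof -
  have "formQ T x y = formQ T (lincomb R (\<lambda>k. formQ T x (R k) / d k)) y"
    using orthogonal_basis_expansion[OF assms(1), of x] by simp
  also have "\<dots> = (\<Sum>k\<in>UNIV. formQ T x (R k) * formQ T y (R k) / d k)"
    unfolding formQ_lincomb_left using formQ_sym[of T y] assms(2) by (intro sum.cong refl) simp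
  finally show ?thesis .
qed

text \<open>Clearing denominators extends nondegeneracy from the lattice to its rational
  span.\<close>

lemma bilinear_lattice_nondegenerate:
  assumes "bilinear_lattice F" "\<And>y. formQ F x y = 0"
  shows "x = 0"
proof -
  obtain t where t: "t > 0" "\<forall>k. t * x k \<in> \<int>" by (rule ex_common_denominator)
  have "(\<lambda>i. t * x i) \<in> Zvec" using t by (simp add: Zvec_def)
  moreover have "\<forall>y\<in>Zvec. formQ F (\<lambda>i. t * x i) y = 0" using assms(2) by (simp add: formQ_scale_left)
  ultimately have "(\<lambda>i. t * x i) = 0" using assms(1) by (auto simp: bilinear_lattice_def)
  then have "t * x i = 0" for i by (metis zero_fun_apply)
  then show ?thesis using t by (auto simp: zero_fun_def)
qed

text \<open>The square matrix with the functionals \<open>formQ F (R i)\<close> as rows for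
  \<open>i \<in> I\<close>, and zero rows elsewhere, is singular because row \<open>i0\<close>
  vanishes; \<open>x\<close> is taken from its kernel.\<close>

lemma ex_orthogonal_vector:
  fixes F :: "'n::finite \<Rightarrow> 'n \<Rightarrow> int" and R :: "'n \<Rightarrow> 'n \<Rightarrow> rat"
  assumes "i0 \<notin> I"
  obtains x where "x \<noteq> 0" "\<forall>i\<in>I. formQ F (R i) x = 0"
proof -
  define A :: "rat^'n^'n" where
    "A = (\<chi> i j. if i \<in> I then \<Sum>l\<in>UNIV. R i l * of_int (F l j) else 0)"
  have "\<not> (\<exists>B. B ** A = mat 1)"
  proof
    assume "\<exists>B. B ** A = mat 1"
    then obtain B where "A ** B = mat 1" by (metis matrix_left_right_inverse)
    then have "(A ** B) $ i0 $ i0 = (mat 1 :: rat^'n^'n) $ i0 $ i0" by simp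
    then show False using assms by (simp add: matrix_matrix_mult_def A_def mat_def)
  qed
  then obtain x where x: "A *v x = 0" "x \<noteq> 0" using matrix_left_invertible_ker by blast
  have "formQ F (R i) (\<lambda>j. x $ j) = 0" if "i \<in> I" for i
  proof -
    have "formQ F (R i) (\<lambda>j. x $ j) = (A *v x) $ i"
      unfolding formQ_def using that
      by (subst sum.swap) (simp add: A_def matrix_vector_mult_def sum_distrib_right)
    then show ?thesis using x by simp
  qed
  moreover have "(\<lambda>j. x $ j) \<noteq> 0" using x(2) by (metis vec_eq_iff zero_fun_apply zero_index)
  ultimately show ?thesis using that by blast
qed

text \<open>An orthogonal anisotropic family is extended by an anisotropic vector of its complement
  \<open>U\<close>. If \<open>U\<close> were totally isotropic, a nonzero \<open>x\<close> in
  \<open>U\<close> would be orthogonal to \<open>U\<close> and to the family, hence to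
  everything.\<close>

lemma ex_orthogonal_basis:
  fixes F :: "'n::finite \<Rightarrow> 'n \<Rightarrow> int"
  assumes F: "bilinear_lattice F"
  obtains R d where "orthogonal_basis F R d"
proof -
  have sym: "formQ F x y = formQ F y x" for x y
    using F by (intro formQ_sym) (simp add: bilinear_lattice_def)
  have "\<exists>R. \<forall>k\<in>I. formQ F (R k) (R k) \<noteq> 0 \<and> (\<forall>l\<in>I. k \<noteq> l \<longrightarrow> formQ F (R k) (R l) = 0)"
    if "finite I" for I :: "'n set"
    using that
  proof (induction I rule: finite_induct)
    case (insert i0 I)
    then obtain R where R: "\<And>k. k \<in> I \<Longrightarrow> formQ F (R k) (R k) \<noteq> 0"
      "\<And>k l. k \<in> I \<Longrightarrow> l \<in> I \<Longrightarrow> k \<noteq> l \<Longrightarrow> formQ F (R k) (R l) = 0" by blast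
    define U where "U = {x. \<forall>i\<in>I. formQ F (R i) x = 0}"
    obtain x where x0: "x \<noteq> 0" "\<forall>i\<in>I. formQ F (R i) x = 0"
      by (rule ex_orthogonal_vector[OF insert.hyps(2), of F R])
    then have x: "x \<noteq> 0" "x \<in> U" unfolding U_def by auto
    have "\<exists>y\<in>U. formQ F y y \<noteq> 0"
    proof (rule ccontr)
      assume "\<not> (\<exists>y\<in>U. formQ F y y \<noteq> 0)"
      then have iso: "formQ F y y = 0" if "y \<in> U" for y using that by blast
      have "formQ F x w = 0" for w
      proof -
        \<comment> \<open>The orthogonal projection of \<open>w\<close> onto the span of the family,
          so that \<open>w - p\<close> falls into \<open>U\<close>.\<close>
        define p where "p = lincomb R (\<lambda>k. if k \<in> I then formQ F (R k) w / formQ F (R k) (R k) else 0)"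
        have pR: "formQ F p (R i) = formQ F (R i) w" if "i \<in> I" for i
        proof -
          have "formQ F p (R i) = (\<Sum>k\<in>UNIV. if k = i then formQ F (R k) w else 0)"
            unfolding p_def formQ_lincomb_left using R that by (intro sum.cong refl) auto
          then show ?thesis by simp
        qed
        have "w - p \<in> U"
          unfolding U_def using pR by (auto simp: sym[of _ "w - p"] formQ_diff_left sym[of w])
        then have "x + (w - p) \<in> U" using x by (simp add: U_def formQ_add_right)
        \<comment> \<open>Polarisation: \<open>x\<close>, \<open>w - p\<close> and their sum are all
          isotropic.\<close>
        have "formQ F x (w - p) = 0"
          using iso[OF \<open>x + (w - p) \<in> U\<close>] iso[OF x(2)] iso[OF \<open>w - p \<in> U\<close>] sym[of x "w - p"]
          by (simp add: formQ_add_left formQ_add_right)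
        moreover have "formQ F p x = 0"
          unfolding p_def formQ_lincomb_left using x(2) by (intro sum.neutral) (auto simp: U_def)
        ultimately show ?thesis using sym[of x "w - p"] sym[of x w] sym[of p x] by (simp add: formQ_diff_left)
      qed
      then show False using bilinear_lattice_nondegenerate[OF F] x by blast
    qed
    then obtain y where y: "y \<in> U" "formQ F y y \<noteq> 0" by blast
    have "formQ F (R k) y = 0" "formQ F y (R k) = 0" if "k \<in> I" for k
      using y(1) that sym[of y "R k"] by (simp_all add: U_def)
    then show ?case
      using R y(2) insert.hyps(2) by (intro exI[of _ "R(i0 := y)"]) auto
  qed simp
  from this[of UNIV] obtain R :: "'n \<Rightarrow> 'n \<Rightarrow> rat"
    where "\<forall>k. formQ F (R k) (R k) \<noteq> 0 \<and> (\<forall>l. k \<noteq> l \<longrightarrow> formQ F (R k) (R l) = 0)"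
    by auto
  then have "orthogonal_basis F R (\<lambda>k. formQ F (R k) (R k))" by (auto simp: orthogonal_basis_def)
  then show ?thesis using that by blast
qed

section \<open>Sylvester's law of inertia\<close>

definition real_form :: "('n::finite \<Rightarrow> 'n \<Rightarrow> int) \<Rightarrow> real^'n \<Rightarrow> real^'n \<Rightarrow> real" where
  "real_form F x y = (\<Sum>i\<in>UNIV. \<Sum>j\<in>UNIV. x$i * of_int (F i j) * y$j)"

lemma real_form_bilinear: "bilinear (real_form F)"
  unfolding bilinear_def
  by (auto intro!: linearI simp: real_form_def algebra_simps sum.distrib sum_distrib_left)

lemma real_qform_conv_real_form: "real_qform F x = real_form F x x"
  by (simp add: real_qform_def real_form_def)

lemma orthogonal_span_expansion:
  fixes E :: "'n::finite \<Rightarrow> real^'n"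
  assumes orth: "\<And>k l. real_form F (E k) (E l) = (if k = l then d k else 0)" and d: "\<And>k. d k \<noteq> 0"
    and "x \<in> span (E ` P)"
  obtains c where "x = (\<Sum>k\<in>P. c k *\<^sub>R E k)" "real_qform F x = (\<Sum>k\<in>P. d k * (c k)\<^sup>2)"
proof -
  have inj: "inj E" using orth d by (metis injI)
  obtain u where "x = (\<Sum>v\<in>E ` P. u v *\<^sub>R v)"
    using assms(3) by (auto simp: span_finite)
  then have x: "x = (\<Sum>k\<in>P. u (E k) *\<^sub>R E k)"
    using inj by (subst (asm) sum.reindex) (auto simp: inj_on_def)
  have "real_qform F x = (\<Sum>(k, l)\<in>P \<times> P. real_form F (u (E k) *\<^sub>R E k) (u (E l) *\<^sub>R E l))"
    using bilinear_sum[OF real_form_bilinear, of F "\<lambda>k. u (E k) *\<^sub>R E k" P "\<lambda>k. u (E k) *\<^sub>R E k" P]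
    by (simp only: real_qform_conv_real_form x[symmetric])
  also have "\<dots> = (\<Sum>k\<in>P. \<Sum>l\<in>P. if k = l then d k * (u (E k))\<^sup>2 else 0)"
    unfolding sum.cartesian_product
    by (rule sum.cong) (auto simp: bilinear_lmul[OF real_form_bilinear] bilinear_rmul[OF real_form_bilinear]
          orth power2_eq_square)
  also have "\<dots> = (\<Sum>k\<in>P. d k * (u (E k))\<^sup>2)" by simp
  finally show ?thesis using that[of "\<lambda>k. u (E k)"] x by blast
qed

lemma dim_span_orthogonal:
  fixes E :: "'n::finite \<Rightarrow> real^'n"
  assumes orth: "\<And>k l. real_form F (E k) (E l) = (if k = l then d k else 0)" and d: "\<And>k. d k \<noteq> 0"
  shows "dim (span (E ` P)) = card P"
proof -
  have inj: "inj E" using orth d by (metis injI)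
  have "independent (E ` P)"
  proof (rule independent_if_scalars_zero)
    fix f v assume f: "(\<Sum>v\<in>E ` P. f v *\<^sub>R v) = 0" and "v \<in> E ` P"
    then obtain l where l: "l \<in> P" "v = E l" by auto
    have "0 = real_form F (\<Sum>k\<in>P. f (E k) *\<^sub>R E k) (E l)"
      using f inj bilinear_lzero[OF real_form_bilinear] by (simp add: sum.reindex inj_on_def)
    also have "\<dots> = (\<Sum>k\<in>P. f (E k) * real_form F (E k) (E l))"
      using real_form_bilinear[of F]
      by (simp add: bilinear_def linear_sum[of "\<lambda>x. real_form F x (E l)"] linear_cmul[of "\<lambda>x. real_form F x (E l)"])
    also have "\<dots> = f v * d l" using l by (simp add: orth if_distrib[of "\<lambda>y. _ * y"] cong: if_cong)
    finally show "f v = 0" using d by simp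
  qed simp
  then show ?thesis using inj by (simp add: dim_eq_card_independent card_image inj_on_def)
qed

text \<open>A positive definite subspace meets the span of the basis vectors with negative
  \<open>d k\<close> only in 0, so its dimension is at most the number of positive
  \<open>d k\<close>; the span of the remaining basis vectors attains this.\<close>

lemma pos_index_eq_card:
  fixes F :: "'n::finite \<Rightarrow> 'n \<Rightarrow> int"
  assumes R: "orthogonal_basis F R d"
  shows "pos_index F = card {k. d k > 0}"
proof -
  define E :: "'n \<Rightarrow> real^'n" where "E k = (\<chi> i. of_rat (R k i))" for k
  define d' where "d' k = (of_rat (d k) :: real)" for k
  have orth: "real_form F (E k) (E l) = (if k = l then d' k else 0)" for k l
  proof -
    have "real_form F (E k) (E l) = of_rat (formQ F (R k) (R l))"
      by (simp add: real_form_def formQ_def E_def of_rat_sum of_rat_mult)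
    then show ?thesis using R by (simp add: orthogonal_basis_def d'_def)
  qed
  have d': "d' k \<noteq> 0" "d' k > 0 \<longleftrightarrow> d k > 0" for k
    using R by (auto simp: orthogonal_basis_def d'_def)
  define P where "P = {k. d k > 0}"
  define N where "N = - P"
  have cPN: "card P + card N = CARD('n)"
    using card_Un_disjoint[of P N] by (simp add: N_def)
  have le: "dim S \<le> card P" if S: "subspace S" "\<forall>x\<in>S. x \<noteq> 0 \<longrightarrow> real_qform F x > 0" for S
  proof -
    have "S \<inter> span (E ` N) \<subseteq> {0}"
    proof
      fix x assume x: "x \<in> S \<inter> span (E ` N)"
      then have "x \<in> span (E ` N)" by blast
      then obtain c where "real_qform F x = (\<Sum>k\<in>N. d' k * (c k)\<^sup>2)"
        by (rule orthogonal_span_expansion[OF orth d'(1)])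
      also have "\<dots> \<le> 0"
        using d' by (intro sum_nonpos mult_nonpos_nonneg) (auto simp: N_def P_def not_less[symmetric])
      finally show "x \<in> {0}" using S x by fastforce
    qed
    then have "dim (S \<inter> span (E ` N)) = 0" by (simp add: dim_eq_0)
    then have "dim S + card N = dim {x + y |x y. x \<in> S \<and> y \<in> span (E ` N)}"
      using dim_sums_Int[OF S(1) subspace_span[of "E ` N"]] dim_span_orthogonal[OF orth d'(1), of N] by linarith
    also have "\<dots> \<le> CARD('n)" using dim_subset_UNIV[of "{x + y |x y. x \<in> S \<and> y \<in> span (E ` N)}"] by simp
    finally show ?thesis using cPN by simp
  qed
  have "real_qform F x > 0" if x: "x \<in> span (E ` P)" "x \<noteq> 0" for x
  proof -
    obtain c where c: "x = (\<Sum>k\<in>P. c k *\<^sub>R E k)" "real_qform F x = (\<Sum>k\<in>P. d' k * (c k)\<^sup>2)"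
      by (rule orthogonal_span_expansion[OF orth d'(1) x(1)])
    have "\<exists>k\<in>P. c k \<noteq> 0"
    proof (rule ccontr)
      assume "\<not> (\<exists>k\<in>P. c k \<noteq> 0)"
      then have "x = 0" unfolding c(1) by simp
      then show False using x(2) by simp
    qed
    then obtain k where k: "k \<in> P" "c k \<noteq> 0" by blast
    have "0 < (\<Sum>k\<in>P. d' k * (c k)\<^sup>2)"
      using k d'(2) by (intro sum_pos2[of _ k]) (auto simp: P_def intro!: mult_nonneg_nonneg less_imp_le[of 0 "d' _"])
    then show ?thesis using c by simp
  qed
  then have "card P \<in> {dim S | S. subspace S \<and> (\<forall>x\<in>S. x \<noteq> 0 \<longrightarrow> real_qform F x > 0)}"
    using dim_span_orthogonal[OF orth d'(1), of P]
    by (auto intro!: exI[of _ "span (E ` P)"])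
  moreover have "finite {dim S | S. subspace S \<and> (\<forall>x\<in>S. x \<noteq> 0 \<longrightarrow> real_qform F x > 0)}"
    using le by (auto intro: finite_subset[OF _ finite_atMost[of "card P"]])
  ultimately show ?thesis
    unfolding pos_index_def P_def[symmetric] using le by (intro Max_eqI) auto
qed

lemma neg_index_eq_card:
  fixes F :: "'n::finite \<Rightarrow> 'n \<Rightarrow> int"
  assumes R: "orthogonal_basis F R d"
  shows "neg_index F = card {k. d k < 0}"
proof -
  have "real_qform (\<lambda>i j. - F i j) x = - real_qform F x" for x
    by (simp add: real_qform_def sum_negf)
  then have "neg_index F = pos_index (\<lambda>i j. - F i j)"
    by (simp add: neg_index_def pos_index_def)
  moreover have "formQ (\<lambda>i j. - F i j) x y = - formQ F x y" for x y
    by (simp add: formQ_def sum_negf)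
  then have "orthogonal_basis (\<lambda>i j. - F i j) R (\<lambda>k. - d k)"
    using R by (simp add: orthogonal_basis_def)
  ultimately show ?thesis using pos_index_eq_card by fastforce
qed

text \<open>In this form multiplicativity under tensor products is visible: the signs of the tensor
  basis are the products of signs.\<close>

lemma signature_eq_sum_sgn:
  assumes R: "orthogonal_basis F R d"
  shows "of_int (signature F) = (\<Sum>k\<in>UNIV. sgn (d k))"
proof -
  have "(\<Sum>k\<in>UNIV. sgn (d k)) = (\<Sum>k\<in>UNIV. (if d k > 0 then 1 else 0) - (if d k < 0 then 1 else 0))"
    by (intro sum.cong refl) (auto simp: sgn_if)
  also have "\<dots> = of_nat (card {k. d k > 0}) - of_nat (card {k. d k < 0})"
    by (simp add: sum_subtractf sum.If_cases)
  finally show ?thesis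
    by (simp add: signature_def pos_index_eq_card[OF R] neg_index_eq_card[OF R])
qed

section \<open>The Milgram--van der Blij formula\<close>

lemma sgn_of_int: "sgn (of_int n :: 'a::linordered_idom) = of_int (sgn n)"
  by (simp add: sgn_if)

text \<open>The rank one case. With \<open>j = c + i\<close> the numerator becomes
  \<open>i\<^sup>2 - c\<^sup>2\<close>, which leaves the classical sum for \<open>D > 0\<close> and
  its conjugate for \<open>D < 0\<close>.\<close>

lemma sum_ee_quadratic:
  fixes D c :: int
  assumes "even D" "D \<noteq> 0"
  shows "(\<Sum>j\<in>{c..<c + \<bar>D\<bar>}. ee (((of_int j)\<^sup>2 - 2 * of_int c * of_int j) / (2 * of_int D)))
       = ee (- (of_int c)\<^sup>2 / (2 * of_int D)) * (of_real (sqrt \<bar>of_int D\<bar>) * cis (pi / 4 * sgn (of_int D)))"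
proof -
  define d where "d = nat \<bar>D\<bar>"
  have d: "even d" "d > 0" "int d = \<bar>D\<bar>" using assms by (auto simp: d_def even_nat_iff)
  have shift: "ee (((of_int (c + int i))\<^sup>2 - 2 * of_int c * of_int (c + int i)) / (2 * of_int D))
      = ee (- (of_int c)\<^sup>2 / (2 * of_int D)) * ee ((of_nat i)\<^sup>2 / (2 * of_int D))" for i
    unfolding ee_add[symmetric] by (simp add: power2_eq_square algebra_simps add_divide_distrib diff_divide_distrib)
  have chirp: "ee ((of_nat i)\<^sup>2 / (2 * of_int D)) = (if D > 0 then chirp d i else cnj (chirp d i))" for i
  proof -
    have "ee ((of_nat i)\<^sup>2 / (2 * of_int D)) = cis (pi * (real i)\<^sup>2 / of_int D)"
      by (simp add: ee_conv_cis of_rat_divide of_rat_mult of_rat_power)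
    moreover have "real d = (if D > 0 then of_int D else - of_int D)"
      using d(3) by (metis abs_if assms(2) linorder_neqE_linordered_idom of_int_minus of_int_of_nat_eq not_less_iff_gr_or_eq)
    ultimately show ?thesis by (auto simp: chirp_def cis_cnj)
  qed
  have "(\<Sum>j\<in>{c..<c + \<bar>D\<bar>}. ee (((of_int j)\<^sup>2 - 2 * of_int c * of_int j) / (2 * of_int D)))
      = (\<Sum>i<d. ee (((of_int (c + int i))\<^sup>2 - 2 * of_int c * of_int (c + int i)) / (2 * of_int D)))"
    by (rule sum.reindex_bij_witness[of _ "\<lambda>i. c + int i" "\<lambda>j. nat (j - c)"]) (auto simp: d(3)[symmetric])
  also have "\<dots> = ee (- (of_int c)\<^sup>2 / (2 * of_int D)) * (\<Sum>i<d. if D > 0 then chirp d i else cnj (chirp d i))"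
    unfolding shift chirp by (rule sum_distrib_left[symmetric])
  also have "(\<Sum>i<d. if D > 0 then chirp d i else cnj (chirp d i))
      = (if D > 0 then quad_gauss d else cnj (quad_gauss d))"
    by (simp add: quad_gauss_def)
  also have "\<dots> = of_real (sqrt \<bar>of_int D\<bar>) * cis (pi / 4 * sgn (of_int D))"
  proof -
    have "real d = \<bar>of_int D\<bar>" using d(3) by (metis of_int_abs of_int_of_nat_eq)
    then show ?thesis using assms(2) by (simp add: quad_gauss_eq[OF d(1,2)] cis_cnj sgn_if)
  qed
  finally show ?thesis .
qed

lemma ee_sum: "finite S \<Longrightarrow> ee (\<Sum>k\<in>S. f k) = (\<Prod>k\<in>S. ee (f k))"
  by (induction S rule: finite_induct) (auto simp: ee_add, simp add: ee_def)

lemma prod_cis: "finite S \<Longrightarrow> (\<Prod>k\<in>S. cis (f k)) = cis (\<Sum>k\<in>S. f k)"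
  by (induction S rule: finite_induct) (auto simp: cis_mult)

section \<open>The discriminant function and sublattices of finite index\<close>

lemma disc_add:
  assumes "\<And>i j. T i j = T j i"
  shows "disc T v (x + y) = disc T v x + disc T v y + formQ T x y"
  using formQ_sym[of T y x, OF assms]
  by (simp add: disc_def formQ_add_left formQ_add_right field_simps)

lemma disc_Ints:
  assumes "wu_class T v" "x \<in> Zvec"
  shows "disc T v x \<in> \<int>"
proof -
  obtain k :: int where "formQ T x x - formQ T x v = 2 * of_int k" using assms by (auto simp: wu_class_def)
  then have "disc T v x = of_int k" by (simp add: disc_def)
  then show ?thesis by simp
qed

lemma subgroup_Zvec: "add_subgroup Zvec"
  by (simp add: add_subgroup_def Zvec_0 Zvec_diff)

lemma subgroup_dual_lattice: "add_subgroup (dual_lattice T)"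
  by (auto simp: add_subgroup_def dual_lattice_def formQ_diff_left)

lemma Zvec_subset_dual_lattice: "Zvec \<subseteq> dual_lattice T"
  by (auto simp: dual_lattice_def formQ_Ints)

lemma lincomb_Zvec:
  assumes "\<And>k. R k \<in> Zvec" "\<And>k. c k \<in> \<int>"
  shows "lincomb R c \<in> Zvec"
  using assms by (auto simp: lincomb_def Zvec_def intro!: Ints_sum Ints_mult)

text \<open>Every orthogonal basis satisfies these conditions after scaling by a suitable integer. Evenness makes it
  possible to complete the square over \<open>\<int>\<close> in the Gauss sum of the sublattice that the basis spans.\<close>

locale even_orthogonal_basis =
  fixes T :: "'k::finite \<Rightarrow> 'k \<Rightarrow> int" and R :: "'k \<Rightarrow> 'k \<Rightarrow> rat" and D C :: "'k \<Rightarrow> int" and v :: "'k \<Rightarrow> rat"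
  assumes T_sym: "T i j = T j i"
    and basis: "orthogonal_basis T R (\<lambda>k. of_int (D k))"
    and R_integral: "R k \<in> Zvec"
    and D_even: "even (D k)"
    and wu: "wu_class T v"
    and v_R: "formQ T v (R k) = 2 * of_int (C k)"
begin

text \<open>The quotients are the coordinates of \<open>x\<close> in the basis \<open>R\<close>, so
  this is the lattice that \<open>R\<close> spans; \<open>sub_dual\<close> is its dual.\<close>

definition sub :: "('k \<Rightarrow> rat) set" where
  "sub = {x. \<forall>k. formQ T x (R k) / of_int (D k) \<in> \<int>}"

definition sub_dual :: "('k \<Rightarrow> rat) set" where
  "sub_dual = {x. \<forall>k. formQ T x (R k) \<in> \<int>}"

definition point :: "('k \<Rightarrow> int) \<Rightarrow> 'k \<Rightarrow> rat" where
  "point j = lincomb R (\<lambda>k. of_int (j k) / of_int (D k))"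

text \<open>The box starts at \<open>C\<close>, so that completing the square moves it to the origin.\<close>

definition box :: "('k \<Rightarrow> int) set" where
  "box = (\<Pi>\<^sub>E k\<in>UNIV. {C k..<C k + \<bar>D k\<bar>})"

lemma D_nonzero: "D k \<noteq> 0"
  using basis by (auto simp: orthogonal_basis_def)

lemma formQ_R: "formQ T (R k) (R l) = (if k = l then of_int (D k) else 0)"
  using basis by (auto simp: orthogonal_basis_def)

lemma formQ_point: "formQ T (point j) (R k) = of_int (j k)"
proof -
  have "formQ T (point j) (R k) = (\<Sum>l\<in>UNIV. of_int (j l) / of_int (D l) * (if l = k then of_int (D l) else 0))"
    by (simp add: point_def formQ_lincomb_left formQ_R)
  also have "\<dots> = (\<Sum>l\<in>UNIV. if l = k then of_int (j l) else 0)"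
    using D_nonzero by (intro sum.cong refl) auto
  finally show ?thesis by simp
qed

lemma subgroup_sub: "add_subgroup sub"
  by (auto simp: add_subgroup_def sub_def formQ_diff_left diff_divide_distrib)

lemma subgroup_sub_dual: "add_subgroup sub_dual"
  by (auto simp: add_subgroup_def sub_dual_def formQ_diff_left)

lemma sub_subset_Zvec: "sub \<subseteq> Zvec"
proof
  fix x assume "x \<in> sub"
  then have "lincomb R (\<lambda>k. formQ T x (R k) / of_int (D k)) \<in> Zvec"
    by (intro lincomb_Zvec R_integral) (auto simp: sub_def)
  then show "x \<in> Zvec" using orthogonal_basis_expansion[OF basis, of x] by simp
qed

lemma Zvec_subset_sub_dual: "Zvec \<subseteq> sub_dual"
  by (auto simp: sub_dual_def formQ_Ints R_integral)

text \<open>By pairing with the \<open>R k\<close>, \<open>sub_dual / sub\<close> is the product of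
  the cyclic groups of order \<open>\<bar>D k\<bar>\<close>; \<open>box\<close> holds one integer
  from every residue class in each coordinate.\<close>

lemma transversal_point: "transversal sub_dual sub (point ` box)"
  unfolding transversal_def
proof (intro conjI ballI)
  show "point ` box \<subseteq> sub_dual" by (auto simp: sub_dual_def formQ_point)
  fix x assume "x \<in> sub_dual"
  then have "\<forall>k. \<exists>m::int. formQ T x (R k) = of_int m" by (auto simp: sub_dual_def Ints_def)
  then obtain m :: "'k \<Rightarrow> int" where m: "\<And>k. formQ T x (R k) = of_int (m k)" by metis
  have sub_iff: "x - point j \<in> sub \<longleftrightarrow> (\<forall>k. D k dvd m k - j k)" for j
  proof -
    have "of_int a / of_int (D k) \<in> (\<int> :: rat set) \<longleftrightarrow> D k dvd a" for a k
      using D_nonzero[of k] by (auto simp: of_int_div_of_int_in_Ints_iff)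
    then have "(of_int (m k) - of_int (j k)) / of_int (D k) \<in> (\<int> :: rat set) \<longleftrightarrow> D k dvd m k - j k" for k
      by (metis of_int_diff)
    then show ?thesis by (simp add: sub_def formQ_diff_left m formQ_point)
  qed
  define j where "j k = C k + (m k - C k) mod \<bar>D k\<bar>" for k
  have "j \<in> box" using D_nonzero by (auto simp: box_def j_def)
  have "D k dvd m k - j k" for k
  proof -
    have "m k - j k = (m k - C k) - (m k - C k) mod \<bar>D k\<bar>" by (simp add: j_def)
    then have "\<bar>D k\<bar> dvd m k - j k" by (metis dvd_minus_mod)
    then show ?thesis by simp
  qed
  then have xj: "x - point j \<in> sub" by (simp add: sub_iff)
  show "\<exists>!r. r \<in> point ` box \<and> x - r \<in> sub"
  proof
    show "point j \<in> point ` box \<and> x - point j \<in> sub" using \<open>j \<in> box\<close> xj by simp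
    fix r assume "r \<in> point ` box \<and> x - r \<in> sub"
    then obtain i where i: "r = point i" "i \<in> box" "\<And>k. D k dvd m k - i k" using sub_iff by auto
    have "i k = j k" for k
    proof -
      have "D k dvd m k - j k" using xj sub_iff by blast
      then have "D k dvd (m k - j k) - (m k - i k)" using i(3)[of k] by (rule dvd_diff)
      then have dvd: "D k dvd i k - j k" by simp
      have less: "\<bar>i k - j k\<bar> < \<bar>D k\<bar>"
        using i(2) \<open>j \<in> box\<close> by (auto simp: box_def PiE_iff dest!: spec[of _ k])
      have "i k - j k = 0"
      proof (rule ccontr)
        assume "i k - j k \<noteq> 0"
        then have "\<bar>D k\<bar> \<le> \<bar>i k - j k\<bar>" using dvd by (rule dvd_imp_le_int)
        then show False using less by linarith
      qed
      then show ?thesis by simp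
    qed
    then show "r = point j" using i(1) by (simp add: point_def)
  qed
qed

lemma inj_point: "inj point"
proof (rule injI)
  fix i j assume "point i = point j"
  then have "of_int (i k) = (of_int (j k) :: rat)" for k using formQ_point by metis
  then show "i = j" by auto
qed

lemma disc_point:
  "disc T v (point j) = (\<Sum>k\<in>UNIV. ((of_int (j k))\<^sup>2 - 2 * of_int (C k) * of_int (j k)) / (2 * of_int (D k)))"
proof -
  note f = orthogonal_basis_formQ[OF basis T_sym]
  have "disc T v (point j) = ((\<Sum>k\<in>UNIV. of_int (j k) * of_int (j k) / of_int (D k))
      - (\<Sum>k\<in>UNIV. of_int (j k) * (2 * of_int (C k)) / of_int (D k))) / 2"
    unfolding disc_def f[of "point j" "point j"] f[of "point j" v] formQ_point v_R ..
  then show ?thesis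
    by (simp add: sum_subtractf[symmetric] sum_divide_distrib power2_eq_square diff_divide_distrib ac_simps)
qed

lemma formQ_v_v: "formQ T v v = (\<Sum>k\<in>UNIV. 4 * (of_int (C k))\<^sup>2 / of_int (D k))"
  unfolding orthogonal_basis_formQ[OF basis T_sym, of v v] v_R by (simp add: power2_eq_square ac_simps)

sublocale quadratic_cosets sub_dual sub "disc T v" "formQ T"
proof
  show "finite (cosets sub_dual sub)"
    using transversal_finite_iff[OF subgroup_sub transversal_point]
    by (simp add: box_def finite_PiE)
  show "formQ T x l \<in> \<int>" if "x \<in> sub_dual" "l \<in> sub" for x l
  proof -
    have "formQ T x l = (\<Sum>k\<in>UNIV. formQ T x (R k) * (formQ T l (R k) / of_int (D k)))"
      by (subst orthogonal_basis_formQ[OF basis T_sym]) simp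
    also have "\<dots> \<in> \<int>" using that by (intro Ints_sum Ints_mult) (auto simp: sub_def sub_dual_def)
    finally show ?thesis .
  qed
qed (use sub_subset_Zvec Zvec_subset_sub_dual disc_Ints[OF wu] in
     \<open>auto simp: subgroup_sub subgroup_sub_dual disc_add T_sym formQ_add_right intro: formQ_sym[OF T_sym]\<close>)

text \<open>The sum over \<open>box\<close> factors into rank one sums. Their constants from
  completing the square add up to \<open>- formQ T v v / 8\<close>, and their eighth roots of unity
  to the sum of signs.\<close>

lemma gsum_sub_dual:
  "gsum sub_dual = of_real (\<Prod>k\<in>UNIV. sqrt \<bar>of_int (D k)\<bar>)
     * exp (of_real pi * \<i> / 4 * ((\<Sum>k\<in>UNIV. of_int (sgn (D k))) - of_rat (formQ T v v)))"
proof -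
  let ?q = "\<lambda>k (j::int). ((of_int j)\<^sup>2 - 2 * of_int (C k) * of_int j) / (2 * of_int (D k)) :: rat"
  have "gsum sub_dual = (\<Sum>x\<in>point ` box. ee (disc T v x))"
    unfolding gsum_def by (rule csum_transversal[OF subgroup_sub transversal_point]) (rule ee_q_invariant)
  also have "\<dots> = (\<Sum>j\<in>box. \<Prod>k\<in>UNIV. ee (?q k (j k)))"
    using inj_point by (subst sum.reindex) (auto simp: inj_on_def disc_point ee_sum)
  also have "\<dots> = (\<Prod>k\<in>UNIV. \<Sum>j\<in>{C k..<C k + \<bar>D k\<bar>}. ee (?q k j))"
    unfolding box_def by (rule prod_sum_PiE[symmetric]) auto
  also have "\<dots> = (\<Prod>k\<in>UNIV. ee (- (of_int (C k))\<^sup>2 / (2 * of_int (D k)))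
      * (of_real (sqrt \<bar>of_int (D k)\<bar>) * cis (pi / 4 * sgn (of_int (D k)))))"
    by (intro prod.cong refl sum_ee_quadratic D_even D_nonzero)
  also have "\<dots> = ee (\<Sum>k\<in>UNIV. - (of_int (C k))\<^sup>2 / (2 * of_int (D k)))
      * (of_real (\<Prod>k\<in>UNIV. sqrt \<bar>of_int (D k)\<bar>) * cis (\<Sum>k\<in>UNIV. pi / 4 * sgn (of_int (D k))))"
    by (simp add: prod.distrib ee_sum prod_cis)
  also have "(\<Sum>k\<in>UNIV. - (of_int (C k))\<^sup>2 / (2 * of_int (D k))) = - formQ T v v / 8"
    by (simp add: formQ_v_v sum_divide_distrib sum_negf[symmetric])
  also have "ee (- formQ T v v / 8) = exp (of_real pi * \<i> / 4 * (- of_rat (formQ T v v)))"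
    by (simp add: ee_def of_rat_minus of_rat_divide field_simps)
  finally have "gsum sub_dual = exp (of_real pi * \<i> / 4 * (- of_rat (formQ T v v)))
      * (of_real (\<Prod>k\<in>UNIV. sqrt \<bar>of_int (D k)\<bar>) * cis (\<Sum>k\<in>UNIV. pi / 4 * sgn (of_int (D k))))" .
  moreover have "cis (\<Sum>k\<in>UNIV. pi / 4 * sgn (of_int (D k)))
      = exp (of_real pi * \<i> / 4 * (\<Sum>k\<in>UNIV. of_int (sgn (D k))))"
    by (simp add: cis_conv_exp sum_distrib_left sum_divide_distrib ac_simps sgn_of_int)
  moreover have "exp (x * (s - f)) = exp (x * (- f)) * exp (x * s)" for x s f :: complex
    by (simp add: algebra_simps flip: exp_add)
  ultimately show ?thesis by (simp only: mult.left_commute)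
qed

lemma perp_Zvec: "perp Zvec = dual_lattice T"
  unfolding perp_def using R_integral by (auto simp: dual_lattice_def sub_dual_def)

text \<open>\<open>gsum_coarser_lattice\<close> applies to
  \<open>sub \<subseteq> Zvec \<subseteq> sub_dual\<close>, since the Wu condition makes
  \<open>disc\<close> integral on \<open>Zvec\<close>.\<close>

lemma discriminant_gauss_sum:
  obtains r where "r > 0" "csum (dual_lattice T) Zvec (\<lambda>x. ee (disc T v x)) =
    of_real r * exp (of_real pi * \<i> / 4 * ((\<Sum>k\<in>UNIV. of_int (sgn (D k))) - of_rat (formQ T v v)))"
proof
  let ?n = "card (cosets Zvec sub)" and ?p = "\<Prod>k\<in>UNIV. sqrt \<bar>of_int (D k)\<bar>"
  have "?n > 0" using Zvec_0 by (intro card_cosets_pos finite_cosets_subset Zvec_subset_sub_dual) auto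
  moreover have "?p > 0" using D_nonzero by (intro prod_pos) auto
  ultimately show "?p / ?n > 0" by simp
  have "gsum sub_dual = of_nat ?n * csum (dual_lattice T) Zvec (\<lambda>x. ee (disc T v x))"
    using gsum_coarser_lattice[OF subgroup_Zvec sub_subset_Zvec Zvec_subset_sub_dual]
    by (simp add: perp_Zvec Zvec_subset_dual_lattice disc_Ints[OF wu])
  then show "csum (dual_lattice T) Zvec (\<lambda>x. ee (disc T v x)) =
    of_real (?p / ?n) * exp (of_real pi * \<i> / 4 * ((\<Sum>k\<in>UNIV. of_int (sgn (D k))) - of_rat (formQ T v v)))"
    using \<open>?n > 0\<close> by (simp add: gsum_sub_dual field_simps)
qed

lemma finite_cosets_dual_lattice: "finite (cosets (dual_lattice T) Zvec)"
proof -
  have "finite (cosets sub_dual Zvec)"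
    using finite_cosets_coarser[OF subgroup_sub_dual subgroup_Zvec subgroup_sub Zvec_subset_sub_dual
        sub_subset_Zvec finite_cosets] .
  moreover have "dual_lattice T \<subseteq> sub_dual" using perp_Zvec by (auto simp: perp_def)
  ultimately show ?thesis using cosets_mono finite_subset by metis
qed

end

text \<open>An arbitrary orthogonal basis is scaled to meet the conditions of the locale. The norms
  are multiplied by a positive square, which keeps the signs of the \<open>d k\<close>.\<close>

lemma milgram_van_der_blij:
  assumes T_sym: "\<And>i j. T i j = T j i" and basis: "orthogonal_basis T R d" and wu: "wu_class T v"
  shows "finite (cosets (dual_lattice T) Zvec)"
    and "\<exists>r>0. csum (dual_lattice T) Zvec (\<lambda>x. ee (disc T v x)) =
      of_real r * exp (of_real pi * \<i> / 4 * (of_rat (\<Sum>k\<in>UNIV. sgn (d k)) - of_rat (formQ T v v)))"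
proof -
  \<comment> \<open>One denominator serves all basis vectors: \<open>R\<close> is read as a single
    vector indexed by pairs.\<close>
  obtain t where t: "t > 0" "\<forall>p. t * (case p of (k, i) \<Rightarrow> R k i) \<in> \<int>"
    by (rule ex_common_denominator)
  define R1 where "R1 k = (\<lambda>i. t * R k i)" for k
  \<comment> \<open>Doubling makes the pairings with \<open>v\<close> even and the norms divisible
    by 4.\<close>
  define R' where "R' k = (\<lambda>i. 2 * R1 k i)" for k
  have R1: "R1 k \<in> Zvec" for k using spec[OF t(2), of "(k, _)"] by (simp add: R1_def Zvec_def)
  have "formQ T v (R1 k) \<in> \<int>" for k
  proof -
    have "formQ T (R1 k) (R1 k) - formQ T (R1 k) v \<in> \<int>"
      using wu R1[of k] by (force simp: wu_class_def)
    from Ints_diff[OF formQ_Ints[OF R1[of k] R1[of k], of T] this] show ?thesis using formQ_sym[of T v "R1 k", OF T_sym] by simp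
  qed
  then have "\<forall>k. \<exists>c::int. formQ T v (R1 k) = of_int c" by (auto simp: Ints_def)
  then obtain C :: "_ \<Rightarrow> int" where C: "\<And>k. formQ T v (R1 k) = of_int (C k)" by metis
  have "\<forall>k. \<exists>c::int. formQ T (R1 k) (R1 k) = of_int c"
    using formQ_Ints[OF R1 R1] by (metis Ints_cases)
  then obtain D :: "_ \<Rightarrow> int" where D: "\<And>k. formQ T (R1 k) (R1 k) = of_int (D k)" by metis
  have formQ_R': "formQ T (R' k) (R' l) = 4 * formQ T (R1 k) (R1 l)" for k l
    by (simp add: R'_def formQ_scale_left formQ_scale_right)
  have formQ_R1: "formQ T (R1 k) (R1 l) = (if k = l then t\<^sup>2 * d k else 0)" for k l
    using basis by (simp add: R1_def formQ_scale_left formQ_scale_right orthogonal_basis_def power2_eq_square)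
  have Dd: "of_int (D k) = t\<^sup>2 * d k" for k using D[of k] formQ_R1[of k k] by simp
  interpret even_orthogonal_basis T R' "\<lambda>k. 4 * D k" C v
  proof
    show "orthogonal_basis T R' (\<lambda>k. of_int (4 * D k))"
      using basis t(1) by (auto simp: orthogonal_basis_def formQ_R' formQ_R1 Dd)
    show "R' k \<in> Zvec" for k using R1[of k] by (simp add: R'_def Zvec_def)
    show "formQ T v (R' k) = 2 * of_int (C k)" for k by (simp add: R'_def formQ_scale_right C)
  qed (use T_sym wu in auto)
  have "of_int (sgn (4 * D k)) = (of_rat (sgn (d k)) :: complex)" for k
  proof -
    have "of_int (sgn (D k)) = sgn (d k)"
      unfolding sgn_of_int[symmetric] Dd using t(1) by (simp add: sgn_mult)
    then have "of_rat (of_int (sgn (D k))) = (of_rat (sgn (d k)) :: complex)" by simp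
    then show ?thesis by (simp add: sgn_mult)
  qed
  then have "(\<Sum>k\<in>UNIV. of_int (sgn (4 * D k))) = (of_rat (\<Sum>k\<in>UNIV. sgn (d k)) :: complex)"
    by (simp add: of_rat_sum)
  then show "\<exists>r>0. csum (dual_lattice T) Zvec (\<lambda>x. ee (disc T v x)) =
      of_real r * exp (of_real pi * \<i> / 4 * (of_rat (\<Sum>k\<in>UNIV. sgn (d k)) - of_rat (formQ T v v)))"
    using discriminant_gauss_sum by metis
  show "finite (cosets (dual_lattice T) Zvec)" by (rule finite_cosets_dual_lattice)
qed

section \<open>Reciprocity for tensor products\<close>

text \<open>The representative chosen in an image coset need not be the image of the one chosen in
  the original coset; the invariance hypothesis makes the two sums agree nevertheless.\<close>

lemma gamma_additive_image:
  fixes \<phi> :: "'a::ab_group_add \<Rightarrow> 'b::ab_group_add"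
  assumes add: "\<And>x y. \<phi> (x + y) = \<phi> x + \<phi> y" and inj: "inj \<phi>"
    and A: "add_subgroup A" and L: "add_subgroup L" "L \<subseteq> A"
    and inv: "\<And>x l. x \<in> \<phi> ` A \<Longrightarrow> l \<in> \<phi> ` L \<Longrightarrow> ee (q (x + l)) = ee (q x)"
  shows "gamma A L (q \<circ> \<phi>) = gamma (\<phi> ` A) (\<phi> ` L) q"
proof -
  have "\<phi> 0 = 0" using add[of 0 0] by simp
  have diff: "\<phi> (x - y) = \<phi> x - \<phi> y" for x y using add[of "x - y" y] by simp
  have subgroup_image: "add_subgroup (\<phi> ` B)" if "add_subgroup B" for B
    using that \<open>\<phi> 0 = 0\<close> unfolding add_subgroup_def by (force simp: diff[symmetric] image_iff)
  have cosets: "cosets (\<phi> ` A) (\<phi> ` L) = (`) \<phi> ` cosets A L"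
    by (simp add: cosets_def image_image add)
  have inj_image: "inj_on ((`) \<phi>) S" for S using inj by (simp add: inj_on_def inj_image_eq_iff)
  have perp: "qperp (\<phi> ` A) (\<phi> ` L) q = (`) \<phi> ` qperp A L (q \<circ> \<phi>)"
    unfolding qperp_def cosets by (auto simp: add)
  obtain R where R: "transversal A L R" using ex_transversal[OF A L] .
  have mem: "\<phi> x \<in> \<phi> ` B \<longleftrightarrow> x \<in> B" for x B using inj by (rule inj_image_mem_iff)
  have "transversal (\<phi> ` A) (\<phi> ` L) (\<phi> ` R)"
    unfolding transversal_def
  proof (intro conjI ballI)
    show "\<phi> ` R \<subseteq> \<phi> ` A" using R by (auto simp: transversal_def)
    fix y assume "y \<in> \<phi> ` A"
    then obtain x where x: "x \<in> A" "y = \<phi> x" by blast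
    then obtain r where r: "r \<in> R" "x - r \<in> L" "\<And>r'. r' \<in> R \<Longrightarrow> x - r' \<in> L \<Longrightarrow> r' = r"
      using R unfolding transversal_def by metis
    show "\<exists>!r. r \<in> \<phi> ` R \<and> y - r \<in> \<phi> ` L"
    proof
      show "\<phi> r \<in> \<phi> ` R \<and> y - \<phi> r \<in> \<phi> ` L" 
        using r(1,2) x(2) by (simp add: diff[symmetric] mem)
      fix s assume "s \<in> \<phi> ` R \<and> y - s \<in> \<phi> ` L"
      then obtain r' where r': "s = \<phi> r'" "r' \<in> R" "\<phi> x - \<phi> r' \<in> \<phi> ` L" unfolding x(2) by blast
      then have "x - r' \<in> L" by (simp add: diff[symmetric] mem)
      then have "r' = r" by (rule r(3)[OF r'(2)])
      then show "s = \<phi> r" using r'(1) by simp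
    qed
  qed
  then have "csum (\<phi> ` A) (\<phi> ` L) (\<lambda>x. ee (q x)) = (\<Sum>r\<in>\<phi> ` R. ee (q r))"
    using inv by (intro csum_transversal subgroup_image L) auto
  also have "\<dots> = (\<Sum>r\<in>R. ee ((q \<circ> \<phi>) r))"
    using inj by (subst sum.reindex) (auto simp: inj_on_def)
  also have "\<dots> = csum A L (\<lambda>x. ee ((q \<circ> \<phi>) x))"
    using inv by (intro csum_transversal[OF L(1) R, symmetric]) (simp add: add)
  finally show ?thesis
    by (simp only: gamma_csum cosets perp card_image[OF inj_image])
qed

section \<open>The maps \<open>j_f\<close> and \<open>j_g\<close>\<close>

lemma add_subgroup_family: "add_subgroup S \<Longrightarrow> add_subgroup {x. \<forall>k. x k \<in> S}"
  by (simp add: add_subgroup_def)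

lemma sum_fun_apply: "(\<Sum>k\<in>S. f k) x = (\<Sum>k\<in>S. f k x :: 'b::comm_monoid_add)"
  by (induction S rule: infinite_finite_induct) auto

lemma j_f_apply: "j_f x (i, k) = x k i"
  by (simp add: j_f_def sum_fun_apply tens_def unitv_def if_distrib[of "\<lambda>y. _ * y"] cong: if_cong)

lemma j_g_apply: "j_g y (i, k) = y i k"
  by (simp add: j_g_def sum_fun_apply tens_def unitv_def if_distrib[of "\<lambda>y. y * _"] cong: if_cong)

lemma j_f_add: "j_f (x + y) = j_f x + j_f y"
  by (auto simp: j_f_apply)

lemma j_g_add: "j_g (x + y) = j_g x + j_g y"
  by (auto simp: j_g_apply)

lemma inj_j_f: "inj j_f"
proof (rule injI, intro ext)
  fix x y :: "'a \<Rightarrow> 'b \<Rightarrow> rat" and k i assume "j_f x = j_f y"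
  then show "x k i = y k i" by (metis j_f_apply)
qed

lemma inj_j_g: "inj j_g"
proof (rule injI, intro ext)
  fix x y :: "'a \<Rightarrow> 'b \<Rightarrow> rat" and k i assume "j_g x = j_g y"
  then show "x k i = y k i" by (metis j_g_apply)
qed

lemma j_f_image:
  fixes S :: "('n \<Rightarrow> rat) set"
  shows "(j_f :: ('m::finite \<Rightarrow> 'n \<Rightarrow> rat) \<Rightarrow> _) ` {x. \<forall>k. x k \<in> S} = {w. \<forall>k. (\<lambda>i. w (i, k)) \<in> S}"
proof (intro equalityI subsetI)
  fix w :: "'n \<times> 'm \<Rightarrow> rat"
  assume "w \<in> {w. \<forall>k. (\<lambda>i. w (i, k)) \<in> S}"
  moreover have "w = j_f (\<lambda>k i. w (i, k))" by (auto simp: j_f_apply)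
  ultimately show "w \<in> j_f ` {x. \<forall>k. x k \<in> S}" by blast
qed (auto simp: j_f_apply)

lemma j_g_image:
  fixes S :: "('m \<Rightarrow> rat) set"
  shows "(j_g :: ('n::finite \<Rightarrow> 'm \<Rightarrow> rat) \<Rightarrow> _) ` {y. \<forall>i. y i \<in> S} = {w. \<forall>i. (\<lambda>k. w (i, k)) \<in> S}"
proof (intro equalityI subsetI)
  fix w :: "'n \<times> 'm \<Rightarrow> rat"
  assume "w \<in> {w. \<forall>i. (\<lambda>k. w (i, k)) \<in> S}"
  moreover have "w = j_g (\<lambda>i k. w (i, k))" by (auto simp: j_g_apply)
  ultimately show "w \<in> j_g ` {x. \<forall>k. x k \<in> S}" by blast
qed (auto simp: j_g_apply)

section \<open>Pairings and duals for the tensor form\<close>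

lemma sum_UNIV_prod: "(\<Sum>p\<in>UNIV. f p) = (\<Sum>i\<in>UNIV. \<Sum>k\<in>UNIV. f (i::'i::finite, k::'k::finite))"
  by (simp add: sum.cartesian_product flip: UNIV_Times_UNIV)

lemma formQ_tens: "formQ (tensor_form F G) (tens x y) (tens x' y') = formQ F x x' * formQ G y y'"
proof -
  have "formQ (tensor_form F G) (tens x y) (tens x' y') =
    (\<Sum>i\<in>UNIV. \<Sum>k\<in>UNIV. \<Sum>j\<in>UNIV. \<Sum>l\<in>UNIV. (x i * of_int (F i j) * x' j) * (y k * of_int (G k l) * y' l))"
    by (simp add: formQ_def sum_UNIV_prod tensor_form_def tens_def ac_simps)
  also have "\<dots> = (\<Sum>i\<in>UNIV. \<Sum>j\<in>UNIV. \<Sum>k\<in>UNIV. \<Sum>l\<in>UNIV. (x i * of_int (F i j) * x' j) * (y k * of_int (G k l) * y' l))"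
    by (intro sum.cong refl sum.swap)
  also have "\<dots> = formQ F x x' * formQ G y y'"
    by (simp only: formQ_def sum_distrib_right) (simp only: sum_distrib_left)
  finally show ?thesis .
qed

lemma tensor_form_sym:
  assumes "\<And>i j. F i j = F j i" "\<And>k l. G k l = G l k"
  shows "tensor_form F G p p' = tensor_form F G p' p"
  using assms by (cases p, cases p') (simp add: tensor_form_def)

lemma orthogonal_basis_tensor:
  assumes "orthogonal_basis F P a" "orthogonal_basis G Q b"
  shows "orthogonal_basis (tensor_form F G) (\<lambda>(i, k). tens (P i) (Q k)) (\<lambda>(i, k). a i * b k)"
  using assms by (auto simp: orthogonal_basis_def formQ_tens)

lemma formQ_column: "formQ F x y = (\<Sum>j\<in>UNIV. (\<Sum>i\<in>UNIV. x i * of_int (F i j)) * y j)"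
  unfolding formQ_def by (subst sum.swap) (simp add: sum_distrib_right)

lemma mem_dual_lattice_iff:
  fixes F :: "'n::finite \<Rightarrow> 'n \<Rightarrow> int"
  shows "x \<in> dual_lattice F \<longleftrightarrow> (\<forall>j. (\<Sum>i\<in>UNIV. x i * of_int (F i j)) \<in> \<int>)"
proof
  assume x: "x \<in> dual_lattice F"
  show "\<forall>j. (\<Sum>i\<in>UNIV. x i * of_int (F i j)) \<in> \<int>"
  proof
    fix j :: 'n
    have "unitv j \<in> Zvec" by (auto simp: unitv_def Zvec_def)
    then have "formQ F x (unitv j) \<in> \<int>" using x by (simp add: dual_lattice_def)
    then show "(\<Sum>i\<in>UNIV. x i * of_int (F i j)) \<in> \<int>"
      by (simp add: formQ_column unitv_def if_distrib[of "\<lambda>y. _ * y"] cong: if_cong)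
  qed
next
  assume x: "\<forall>j. (\<Sum>i\<in>UNIV. x i * of_int (F i j)) \<in> \<int>"
  have "formQ F x y \<in> \<int>" if "y \<in> Zvec" for y
    unfolding formQ_column by (rule Ints_sum) (use x that in \<open>auto simp: Zvec_def intro: Ints_mult\<close>)
  then show "x \<in> dual_lattice F" by (simp add: dual_lattice_def)
qed

text \<open>The vector \<open>y\<close> is a column of the inverse Gram matrix, that is, a member of
  the dual basis: pairing with it reads off the coordinate at \<open>k0\<close>.\<close>

lemma ex_coordinate_functional:
  fixes T :: "'k::finite \<Rightarrow> 'k \<Rightarrow> int"
  assumes "orthogonal_basis T R d"
  obtains y :: "'k \<Rightarrow> rat" where "\<forall>k. (\<Sum>l\<in>UNIV. of_int (T k l) * y l) = (if k = k0 then 1 else 0)"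
proof (rule that, rule allI)
  let ?y = "\<lambda>l. \<Sum>m\<in>UNIV. R m l * R m k0 / d m"
  fix k
  have "(\<Sum>l\<in>UNIV. of_int (T k l) * ?y l) = (\<Sum>l\<in>UNIV. \<Sum>m\<in>UNIV. of_int (T k l) * R m l / d m * R m k0)"
    by (simp add: sum_distrib_left ac_simps)
  also have "\<dots> = (\<Sum>m\<in>UNIV. (\<Sum>l\<in>UNIV. of_int (T k l) * R m l) / d m * R m k0)"
    by (subst sum.swap) (simp add: sum_divide_distrib sum_distrib_right)
  also have "\<dots> = (if k = k0 then 1 else 0)" by (rule orthogonal_basis_inverse[OF assms])
  finally show "(\<Sum>l\<in>UNIV. of_int (T k l) * ?y l) = (if k = k0 then 1 else 0)" .
qed

text \<open>The discriminant pairing is nondegenerate: the dual basis lies in the dual lattice, and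
  pairing with it gives the coordinates of \<open>x\<close>.\<close>

lemma dual_lattice_perp:
  fixes T :: "'k::finite \<Rightarrow> 'k \<Rightarrow> int"
  assumes T_sym: "\<And>i j. T i j = T j i" and basis: "orthogonal_basis T R d"
  shows "{x \<in> dual_lattice T. \<forall>y\<in>dual_lattice T. formQ T x y \<in> \<int>} = Zvec"
proof (intro equalityI subsetI)
  fix x assume x: "x \<in> {x \<in> dual_lattice T. \<forall>y\<in>dual_lattice T. formQ T x y \<in> \<int>}"
  have "x k \<in> \<int>" for k
  proof -
    obtain y :: "'k \<Rightarrow> rat" where y: "\<forall>i. (\<Sum>l\<in>UNIV. of_int (T i l) * y l) = (if i = k then 1 else 0)"
      by (rule ex_coordinate_functional[OF basis])
    have c: "formQ T w y = w k" for w
    proof -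
      have "formQ T w y = (\<Sum>i\<in>UNIV. w i * (\<Sum>l\<in>UNIV. of_int (T i l) * y l))"
        by (simp add: formQ_def sum_distrib_left mult.assoc)
      then show ?thesis by (simp add: y if_distrib[of "\<lambda>y. _ * y"] cong: if_cong)
    qed
    then have "y \<in> dual_lattice T"
      using formQ_sym[of T y, OF T_sym] by (auto simp: dual_lattice_def Zvec_def)
    then show ?thesis using x c by auto
  qed
  then show "x \<in> Zvec" by (simp add: Zvec_def)
next
  fix x :: "'k \<Rightarrow> rat" assume x: "x \<in> Zvec"
  then have "formQ T x y \<in> \<int>" if "y \<in> dual_lattice T" for y
    using that formQ_sym[of T x y, OF T_sym] by (auto simp: dual_lattice_def)
  then show "x \<in> {x \<in> dual_lattice T. \<forall>y\<in>dual_lattice T. formQ T x y \<in> \<int>}"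
    using x Zvec_subset_dual_lattice by auto
qed

text \<open>\<open>F\<close> is applied to the first argument and \<open>G\<close> to the second.
  Integrality of the left factors characterises \<open>V\<^sup>\<sharp> \<otimes> W\<close>, and
  integrality of the right ones \<open>V \<otimes> W\<^sup>\<sharp>\<close>.\<close>

lemma formQ_tensor_form:
  "formQ (tensor_form F G) w w' =
     (\<Sum>j\<in>UNIV. \<Sum>k\<in>UNIV. (\<Sum>i\<in>UNIV. w (i, k) * of_int (F i j)) * (\<Sum>l\<in>UNIV. of_int (G k l) * w' (j, l)))"
proof -
  have "formQ (tensor_form F G) w w' =
     (\<Sum>i\<in>UNIV. \<Sum>k\<in>UNIV. \<Sum>j\<in>UNIV. \<Sum>l\<in>UNIV. w (i, k) * of_int (F i j) * (of_int (G k l) * w' (j, l)))"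
    by (simp add: formQ_def sum_UNIV_prod tensor_form_def mult.assoc)
  also have "\<dots> = (\<Sum>i\<in>UNIV. \<Sum>j\<in>UNIV. \<Sum>k\<in>UNIV. \<Sum>l\<in>UNIV. w (i, k) * of_int (F i j) * (of_int (G k l) * w' (j, l)))"
    by (intro sum.cong refl sum.swap)
  also have "\<dots> = (\<Sum>j\<in>UNIV. \<Sum>i\<in>UNIV. \<Sum>k\<in>UNIV. \<Sum>l\<in>UNIV. w (i, k) * of_int (F i j) * (of_int (G k l) * w' (j, l)))"
    by (rule sum.swap)
  also have "\<dots> = (\<Sum>j\<in>UNIV. \<Sum>k\<in>UNIV. \<Sum>i\<in>UNIV. \<Sum>l\<in>UNIV. w (i, k) * of_int (F i j) * (of_int (G k l) * w' (j, l)))"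
    by (intro sum.cong refl sum.swap)
  finally show ?thesis by (simp add: sum_product)
qed

theorem mainTheorem4:
  fixes F :: "'n::finite \<Rightarrow> 'n \<Rightarrow> int" and G :: "'m::finite \<Rightarrow> 'm \<Rightarrow> int"
    and z :: "'n \<times> 'm \<Rightarrow> rat"
  assumes "bilinear_lattice F" and "bilinear_lattice G"
    and "wu_class (tensor_form F G) z"
  shows "gamma {x. \<forall>k. x k \<in> dual_lattice F} {x. \<forall>k. x k \<in> Zvec}
            (disc (tensor_form F G) z \<circ> j_f)
       = exp (of_real pi * \<i> / 4 *
              (of_int (signature F * signature G) - of_rat (formQ (tensor_form F G) z z)))
         * cnj (gamma {y. \<forall>i. y i \<in> dual_lattice G} {y. \<forall>i. y i \<in> Zvec}
                  (disc (tensor_form F G) z \<circ> j_g))"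
proof -
  let ?T = "tensor_form F G"
  let ?D = "dual_lattice ?T"
  obtain P a where P: "orthogonal_basis F P a" using ex_orthogonal_basis[OF assms(1)] .
  obtain Q b where Q: "orthogonal_basis G Q b" using ex_orthogonal_basis[OF assms(2)] .
  have F_sym: "F i j = F j i" for i j using assms(1) by (simp add: bilinear_lattice_def)
  have G_sym: "G k l = G l k" for k l using assms(2) by (simp add: bilinear_lattice_def)
  have T_sym: "?T p p' = ?T p' p" for p p' using tensor_form_sym[of F G] F_sym G_sym by blast
  note basis = orthogonal_basis_tensor[OF P Q]
  note milgram = milgram_van_der_blij[OF T_sym basis assms(3)]
  have sgn: "(\<Sum>p\<in>UNIV. sgn (case p of (i, k) \<Rightarrow> a i * b k)) = of_int (signature F * signature G)"
    by (simp add: sum_UNIV_prod sgn_mult sum_product signature_eq_sum_sgn[OF P] signature_eq_sum_sgn[OF Q])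
  define u :: complex where "u = exp (of_real pi * \<i> / 4 *
      (of_int (signature F * signature G) - of_rat (formQ ?T z z)))"
  have "norm u = 1"
    by (simp add: u_def complex_of_rat)
  \<comment> \<open>With vectors read as matrices, \<open>H\<close> asks for columns in the dual of
    \<open>V\<close> and \<open>K\<close> for rows in the dual of \<open>W\<close>; these are the
    images of \<open>j_f\<close> and \<open>j_g\<close>.\<close>
  define H where "H = {w::'n \<times> 'm \<Rightarrow> rat. \<forall>k. (\<lambda>i. w (i, k)) \<in> dual_lattice F}"
  define K where "K = {w::'n \<times> 'm \<Rightarrow> rat. \<forall>i. (\<lambda>k. w (i, k)) \<in> dual_lattice G}"
  have H_iff: "w \<in> H \<longleftrightarrow> (\<forall>j k. (\<Sum>i\<in>UNIV. w (i, k) * of_int (F i j)) \<in> \<int>)" for w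
    by (auto simp: H_def mem_dual_lattice_iff)
  have K_iff: "w \<in> K \<longleftrightarrow> (\<forall>j k. (\<Sum>l\<in>UNIV. of_int (G k l) * w (j, l)) \<in> \<int>)" for w
    unfolding K_def mem_dual_lattice_iff using G_sym by (simp add: mult.commute)
  interpret quadratic_cosets ?D Zvec "disc ?T z" "formQ ?T"
  proof
    show "formQ ?T x y = formQ ?T y x" for x y by (rule formQ_sym[OF T_sym])
    show "formQ ?T x l \<in> \<int>" if "x \<in> ?D" "l \<in> Zvec" for x l using that by (simp add: dual_lattice_def)
    show "disc ?T z (x + y) = disc ?T z x + disc ?T z y + formQ ?T x y" for x y by (rule disc_add[OF T_sym])
  qed (simp_all add: milgram(1) disc_Ints[OF assms(3)] Zvec_subset_dual_lattice
      subgroup_dual_lattice subgroup_Zvec formQ_add_right)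
  have HK: "formQ ?T w w' \<in> \<int>" if "w \<in> H" "w' \<in> K" for w w'
    unfolding formQ_tensor_form
    by (rule Ints_sum, rule Ints_sum, rule Ints_mult) (use that in \<open>auto simp: H_iff K_iff\<close>)
  have KH: "formQ ?T w' w \<in> \<int>" if "w \<in> H" "w' \<in> K" for w w'
    using HK[OF that] by (simp only: b_sym[of w' w])
  have ZH: "Zvec \<subseteq> H" and ZK: "Zvec \<subseteq> K"
    using Zvec_subset_dual_lattice[of F] Zvec_subset_dual_lattice[of G]
    by (auto simp: H_def K_def Zvec_def subset_iff)
  \<comment> \<open>\<open>H\<close> and \<open>K\<close> pair integrally with each other, and each
    contains the lattice.\<close>
  have HD: "H \<subseteq> ?D" and KD: "K \<subseteq> ?D"
    using HK KH ZH ZK by (auto simp: dual_lattice_def)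
  have sub: "add_subgroup H" "add_subgroup K"
  proof -
    have "x - y \<in> H" if "x \<in> H" "y \<in> H" for x y
      using that by (simp add: H_iff left_diff_distrib sum_subtractf)
    moreover have "x - y \<in> K" if "x \<in> K" "y \<in> K" for x y
      using that by (simp add: K_iff right_diff_distrib sum_subtractf)
    ultimately show "add_subgroup H" "add_subgroup K"
      using ZH ZK Zvec_0 by (auto simp: add_subgroup_def)
  qed
  have "perp K = H"
  proof (intro equalityI subsetI)
    fix w assume w: "w \<in> perp K"
    have "(\<Sum>i\<in>UNIV. w (i, k) * of_int (F i j)) \<in> \<int>" for j k
    proof -
      obtain y :: "'m \<Rightarrow> rat" where y: "\<forall>k'. (\<Sum>l\<in>UNIV. of_int (G k' l) * y l) = (if k' = k then 1 else 0)"
        by (rule ex_coordinate_functional[OF Q])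
      \<comment> \<open>\<open>e\<^sub>j \<otimes> y\<close> with \<open>y\<close> from the dual
        basis: pairing with it isolates the single sum at \<open>j\<close> and
        \<open>k\<close>.\<close>
      define w' where "w' = (\<lambda>(j', l). if j' = j then y l else 0)"
      have w': "(\<Sum>l\<in>UNIV. of_int (G k' l) * w' (j', l)) = (if k' = k then if j' = j then 1 else 0 else 0)" for j' k'
        using y by (simp add: w'_def)
      then have "w' \<in> K" by (simp add: K_iff)
      then have "formQ ?T w w' \<in> \<int>" using w by (simp add: perp_def)
      then show ?thesis
        by (simp add: formQ_tensor_form w' if_distrib[of "\<lambda>y. _ * y"] cong: if_cong)
    qed
    then show "w \<in> H" by (simp add: H_iff)
  qed (use HK HD in \<open>auto simp: perp_def\<close>)
  moreover have "perp H = K"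
  proof (intro equalityI subsetI)
    fix w' assume w': "w' \<in> perp H"
    have "(\<Sum>l\<in>UNIV. of_int (G k l) * w' (j, l)) \<in> \<int>" for j k
    proof -
      obtain x :: "'n \<Rightarrow> rat" where x: "\<forall>j'. (\<Sum>i\<in>UNIV. of_int (F j' i) * x i) = (if j' = j then 1 else 0)"
        by (rule ex_coordinate_functional[OF P])
      have x': "(\<Sum>i\<in>UNIV. x i * of_int (F i j')) = (if j' = j then 1 else 0)" for j'
        using spec[OF x, of j'] by (simp add: mult.commute F_sym[of _ j'])
      \<comment> \<open>The mirror image, \<open>x \<otimes> e\<^sub>k\<close> with \<open>x\<close>
        from the dual basis of \<open>V\<close>.\<close>
      define w where "w = (\<lambda>(i, k'). if k' = k then x i else 0)"
      have w: "(\<Sum>i\<in>UNIV. w (i, k') * of_int (F i j')) = (if k' = k then if j' = j then 1 else 0 else 0)" for j' k'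
        by (simp add: w_def x')
      then have "w \<in> H" by (simp add: H_iff)
      then have "formQ ?T w w' \<in> \<int>" using w' b_sym[of w w'] by (simp add: perp_def)
      then show ?thesis
        by (simp add: formQ_tensor_form w if_distrib[of "\<lambda>y. y * _"] cong: if_cong)
    qed
    then show "w' \<in> K" by (simp add: K_iff)
  qed (use KH KD in \<open>auto simp: perp_def\<close>)
  moreover have "perp ?D = Zvec"
    unfolding perp_def by (rule dual_lattice_perp[OF T_sym basis])
  moreover obtain r where "r > 0" "gsum ?D = of_real r * u"
    using milgram(2) unfolding gsum_def u_def sgn of_rat_of_int_eq by blast
  ultimately have main: "gamma H Zvec (disc ?T z) = u * cnj (gamma K Zvec (disc ?T z))"
    using gamma_reciprocity[OF sub(1) ZH HD sub(2) ZK KD] \<open>norm u = 1\<close> by blast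
  have Zf: "j_f ` {x. \<forall>k. x k \<in> Zvec} = (Zvec :: ('n \<times> 'm \<Rightarrow> rat) set)"
    and Zg: "j_g ` {x. \<forall>k. x k \<in> Zvec} = (Zvec :: ('n \<times> 'm \<Rightarrow> rat) set)"
    unfolding j_f_image j_g_image by (auto simp: Zvec_def)
  have Hf: "j_f ` {x. \<forall>k. x k \<in> dual_lattice F} = H" and Kg: "j_g ` {y. \<forall>i. y i \<in> dual_lattice G} = K"
    by (simp_all add: j_f_image j_g_image H_def K_def)
  have "gamma {x. \<forall>k. x k \<in> dual_lattice F} {x. \<forall>k. x k \<in> Zvec} (disc ?T z \<circ> j_f)
      = gamma H Zvec (disc ?T z)"
    unfolding Hf[symmetric] Zf[symmetric]
  proof (rule gamma_additive_image[OF j_f_add inj_j_f])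
    show "ee (disc ?T z (x + l)) = ee (disc ?T z x)"
      if "x \<in> j_f ` {x. \<forall>k. x k \<in> dual_lattice F}" "l \<in> j_f ` {x. \<forall>k. x k \<in> Zvec}" for x l
      using that HD unfolding Hf Zf by (intro ee_q_invariant) auto
  qed (use Zvec_subset_dual_lattice in
      \<open>auto intro!: add_subgroup_family subgroup_dual_lattice subgroup_Zvec\<close>)
  moreover have "gamma {y. \<forall>i. y i \<in> dual_lattice G} {y. \<forall>i. y i \<in> Zvec} (disc ?T z \<circ> j_g)
      = gamma K Zvec (disc ?T z)"
    unfolding Kg[symmetric] Zg[symmetric]
  proof (rule gamma_additive_image[OF j_g_add inj_j_g])
    show "ee (disc ?T z (x + l)) = ee (disc ?T z x)"
      if "x \<in> j_g ` {y. \<forall>i. y i \<in> dual_lattice G}" "l \<in> j_g ` {y. \<forall>i. y i \<in> Zvec}" for x l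
      using that KD unfolding Kg Zg by (intro ee_q_invariant) auto
  qed (use Zvec_subset_dual_lattice in
      \<open>auto intro!: add_subgroup_family subgroup_dual_lattice subgroup_Zvec\<close>)
  ultimately show ?thesis using main by (simp add: u_def)
qed

end
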